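(* Consider the fully-distributed gossip network described in the context, with $n$ nodes, source self-update rate $\lambda_e>0$, source-to-network update rate $\lambda>0$, gossip duration $\delta>0$, and total gossip capacity $B=n\lambda$. Then, with $\lambda_e,\lambda,\delta$ fixed, the steady-state mean version age $a_i=\lim_{t\to\infty}\mathbb{E}[\Delta_i(t)]$ of any node $i$ scales as $O(1)$ as $n\to\infty$.
   Context: A source (node $0$) and nodes $\mathcal{N}=\{1,\dots,n\}$ form a fully connected network. The source generates new versions according to a Poisson process of rate $\lambda_e$; $N_s(t)$ is the source's version and $N_i(t)$ node $i$'s version. The source sends its current version to each node according to an independent Poisson process of rate $\lambda/n$. The version age of node $i$ is $\Delta_i(t)=N_s(t)-N_i(t)$: a source self-update increases every $\Delta_i$ by $1$; a source-to-node-$i$ update sets $\Delta_i$ to $0$; when node $j$ successfully gossips to node $i$, node $i$'s age becomes $\min\{\Delta_j(t),\Delta_i(t)\}$. Fully-distributed scheme: whenever a node receives an update from the source, it gossips with total rate $B$ (i.e., sends gossip updates to each of its $n-1$ neighbors according to a Poisson process of rate $B/(n-1)$) for a fixed time duration $\delta$ and then stops. If at some time more than one node is gossiping, the total instantaneous rate exceeds $B$ and interference occurs, so no gossip update is delivered; gossip updates are delivered only while exactly one node is gossiping. The steady-state mean age is $a_i=\lim_{t\to\infty}\mathbb{E}[\Delta_i(t)]$. *)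

theory Defs
  imports "HOL-Probability.Probability"
begin

text \<open>Fully-distributed gossip network with n nodes.  Every Poisson process of the
model is given by its i.i.d. exponential interarrival times.  The processes are:
  Gen        : version generation at the source (rate lambda_e),
  Src i      : source-to-node-i updates (rate lambda/n),
  Gsp j i    : (background) gossip clock of node j towards node i (rate B/(n-1));
               a tick of Gsp j i is a gossip transmission from j to i only while
               j is gossiping, and it is delivered only if j is the unique
               gossiping node (interference otherwise).\<close>

datatype proc = Gen | Src nat | Gsp nat nat

definition procs :: "nat \<Rightarrow> proc set" where
  "procs n = {Gen} \<union> Src ` {1..n} \<union> {Gsp j i | j i. j \<in> {1..n} \<and> i \<in> {1..n} \<and> j \<noteq> i}"

definition rate :: "nat \<Rightarrow> real \<Rightarrow> real \<Rightarrow> real \<Rightarrow> proc \<Rightarrow> real" where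
  "rate n lam_e lam B k = (case k of
      Gen \<Rightarrow> lam_e
    | Src i \<Rightarrow> lam / real n
    | Gsp j i \<Rightarrow> B / (real n - 1))"

definition arr :: "(nat \<Rightarrow> real) \<Rightarrow> nat \<Rightarrow> real" where
  "arr X m = (\<Sum>l\<le>m. X l)"

definition src_ver :: "(proc \<Rightarrow> nat \<Rightarrow> real) \<Rightarrow> real \<Rightarrow> nat" where
  "src_ver X t = card {m. arr (X Gen) m \<le> t}"

definition gossiping :: "(proc \<Rightarrow> nat \<Rightarrow> real) \<Rightarrow> real \<Rightarrow> nat \<Rightarrow> real \<Rightarrow> bool" where
  "gossiping X delta j s \<longleftrightarrow> (\<exists>m. arr (X (Src j)) m \<le> s \<and> s < arr (X (Src j)) m + delta)"

definition delivered :: "nat \<Rightarrow> (proc \<Rightarrow> nat \<Rightarrow> real) \<Rightarrow> real \<Rightarrow> nat \<Rightarrow> real \<Rightarrow> bool" where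
  "delivered n X delta j s \<longleftrightarrow> gossiping X delta j s \<and>
      (\<forall>j'\<in>{1..n}. j' \<noteq> j \<longrightarrow> \<not> gossiping X delta j' s)"

inductive has_ver :: "nat \<Rightarrow> (proc \<Rightarrow> nat \<Rightarrow> real) \<Rightarrow> real \<Rightarrow> nat \<Rightarrow> real \<Rightarrow> nat \<Rightarrow> bool"
  for n X delta where
  init: "has_ver n X delta i t 0"
| from_src: "\<lbrakk> i \<in> {1..n}; arr (X (Src i)) m \<le> t \<rbrakk> \<Longrightarrow>
     has_ver n X delta i t (src_ver X (arr (X (Src i)) m))"
| from_gossip: "\<lbrakk> i \<in> {1..n}; j \<in> {1..n}; j \<noteq> i; has_ver n X delta j s v;
     s < arr (X (Gsp j i)) m; arr (X (Gsp j i)) m \<le> t;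
     delivered n X delta j (arr (X (Gsp j i)) m) \<rbrakk> \<Longrightarrow> has_ver n X delta i t v"

definition node_ver :: "nat \<Rightarrow> (proc \<Rightarrow> nat \<Rightarrow> real) \<Rightarrow> real \<Rightarrow> nat \<Rightarrow> real \<Rightarrow> nat" where
  "node_ver n X delta i t = (GREATEST v. has_ver n X delta i t v)"

definition age :: "nat \<Rightarrow> (proc \<Rightarrow> nat \<Rightarrow> real) \<Rightarrow> real \<Rightarrow> nat \<Rightarrow> real \<Rightarrow> real" where
  "age n X delta i t = real (src_ver X t) - real (node_ver n X delta i t)"

definition gossip_model ::
  "'a measure \<Rightarrow> nat \<Rightarrow> real \<Rightarrow> real \<Rightarrow> real \<Rightarrow> (proc \<Rightarrow> nat \<Rightarrow> 'a \<Rightarrow> real) \<Rightarrow> bool" where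
  "gossip_model M n lam_e lam B X \<longleftrightarrow>
     prob_space.indep_vars M (\<lambda>_. borel) (\<lambda>(k, m). X k m) (procs n \<times> UNIV) \<and>
     (\<forall>k\<in>procs n. \<forall>m. distributed M lborel (X k m) (exponential_density (rate n lam_e lam B k)))"

end

theory Submission
  imports Defs
begin

text \<open>
  Write N for the version counter of the source. For \<open>a \<ge> \<delta>\<close> the truncated age
  \<open>min (\<Delta>\<^sub>i(t)) (N(t) - N(a))\<close> is a function of the Poisson points after time \<open>a - \<delta>\<close>, since an
  update is relevant only if it left the source after \<open>a\<close>, and from then on the set of gossiping nodes is
  determined by the source contacts of the last \<open>\<delta>\<close> time units. Restarting all Poisson processes at a
  fixed time therefore shows that its mean depends only on \<open>t - a\<close>; it increases with \<open>t - a\<close>.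

  Cut time into windows of length \<open>2\<delta>\<close>. In a window, independently of the past and with probability at
  least \<open>p0 > 0\<close> not depending on n, the source contacts exactly one node j at a moment at which nobody
  else gossips, and j then delivers to i; this resets the age of i to at most the number of versions
  generated since the start of the window. Replacing the truncation point by an earlier one at distance
  at most \<open>2\<delta>\<close> thus changes the mean by at most the mean number of versions per window times
  \<open>(1 - p0) ^ l\<close>, where l is the number of complete windows between the later of the two points and t.
  Summing the geometric series bounds the truncated means uniformly in n, and the truncation at \<open>\<delta>\<close> is asymptotically negligible.
\<close>

section \<open>Pathwise analysis\<close>

definition arrivals_upto :: "(nat \<Rightarrow> real) \<Rightarrow> real \<Rightarrow> nat" where
  "arrivals_upto z t = card {m. arr z m \<le> t}"

text \<open>The almost sure properties on which the pathwise arguments rest: positive gaps make the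
  arrival times strictly increasing, and unboundedness makes every counting set finite.\<close>

definition regular :: "(nat \<Rightarrow> real) \<Rightarrow> bool" where
  "regular z \<longleftrightarrow> (\<forall>m. 0 < z m) \<and> (\<forall>t. \<exists>m. t < arr z m)"

text \<open>Interarrival times of the process restarted at time \<open>s\<close>. The values are
  meaningless for sequences that are not regular, where \<open>arrivals_upto\<close>
  may be the cardinality \<open>0\<close> of an infinite set.\<close>

definition residual :: "real \<Rightarrow> (nat \<Rightarrow> real) \<Rightarrow> nat \<Rightarrow> real" where
  "residual s z k = (if k = 0 then arr z (arrivals_upto z s) - s else z (arrivals_upto z s + k))"

lemma src_ver_eq: "src_ver x t = arrivals_upto (x Gen) t"
  by (simp add: src_ver_def arrivals_upto_def)

lemma arr_0: "arr z 0 = z 0"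
  by (simp add: arr_def)

lemma arr_Suc: "arr z (Suc m) = arr z m + z (Suc m)"
  by (simp add: arr_def)

lemma arr_case_nat_Suc: "arr (case_nat a z) (Suc m) = a + arr z m"
  by (induction m) (simp_all add: arr_0 arr_Suc)

lemma arr_case_nat_0: "arr (case_nat a z) 0 = a"
  by (simp add: arr_0)

lemma arr_strict_mono: "regular z \<Longrightarrow> strict_mono (arr z)"
  by (intro strict_monoI_Suc) (simp add: arr_Suc regular_def)

lemma arr_pos: "regular z \<Longrightarrow> 0 < arr z m"
  by (induction m) (auto simp: arr_0 arr_Suc regular_def add_pos_pos)

text \<open>Arrival times increase, so the indices of arrivals up to t are exactly those below the
  first index beyond t, and the cardinality of this initial segment is that index. Later proofs use
  this equivalence instead of \<open>card\<close>.\<close>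

lemma arr_le_iff:
  assumes "regular z"
  shows "arr z m \<le> t \<longleftrightarrow> m < arrivals_upto z t"
proof -
  define k where "k = (LEAST m. t < arr z m)"
  have k: "t < arr z k"
    unfolding k_def by (rule LeastI_ex) (use assms in \<open>auto simp: regular_def\<close>)
  have eq: "arr z m \<le> t \<longleftrightarrow> m < k" for m
  proof
    assume "arr z m \<le> t"
    with k have "arr z m < arr z k" by simp
    then show "m < k" using arr_strict_mono[OF assms] by (simp add: strict_mono_less)
  next
    assume "m < k"
    then show "arr z m \<le> t"
      using not_less_Least[of m "\<lambda>m. t < arr z m"] by (simp add: k_def not_less)
  qed
  have "arrivals_upto z t = k"
    unfolding arrivals_upto_def by (simp add: eq)
  then show ?thesis by (simp add: eq)
qed

lemma arrivals_upto_mono: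
  assumes "regular z" "s \<le> t"
  shows "arrivals_upto z s \<le> arrivals_upto z t"
proof (rule ccontr)
  assume "\<not> ?thesis"
  then have "arr z (arrivals_upto z t) \<le> s" using arr_le_iff[OF assms(1)] by auto
  then have "arr z (arrivals_upto z t) \<le> t" using assms(2) by simp
  then show False using arr_le_iff[OF assms(1)] by auto
qed

lemma arrivals_upto_0: "regular z \<Longrightarrow> arrivals_upto z 0 = 0"
  using arr_le_iff[of z 0 0] arr_pos[of z 0] by auto

lemma arr_residual:
  "arr (residual s z) k = arr z (arrivals_upto z s + k) - s"
  by (induction k) (simp_all add: arr_0 arr_Suc residual_def)

lemma regular_residual:
  assumes "regular z"
  shows "regular (residual s z)"
  unfolding regular_def
proof safe
  fix m show "0 < residual s z m"
    using assms arr_le_iff[OF assms, of "arrivals_upto z s" s]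
    by (auto simp: residual_def regular_def)
next
  fix t
  obtain m where m: "t + s < arr z m" using assms by (auto simp: regular_def)
  have "arr z m \<le> arr z (arrivals_upto z s + m)"
    using arr_strict_mono[OF assms] by (simp add: strict_mono_less_eq)
  then have "t < arr (residual s z) m" using m by (simp add: arr_residual)
  then show "\<exists>m. t < arr (residual s z) m" ..
qed

lemma arrivals_upto_residual:
  assumes "regular z" "0 \<le> u"
  shows "arrivals_upto (residual s z) u = arrivals_upto z (u + s) - arrivals_upto z s"
proof -
  have "k < arrivals_upto (residual s z) u \<longleftrightarrow> k < arrivals_upto z (u + s) - arrivals_upto z s" for k
  proof -
    have "k < arrivals_upto (residual s z) u \<longleftrightarrow> arr (residual s z) k \<le> u"
      by (rule arr_le_iff[OF regular_residual[OF assms(1)], symmetric])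
    also have "\<dots> \<longleftrightarrow> arr z (arrivals_upto z s + k) \<le> u + s"
      by (auto simp: arr_residual)
    also have "\<dots> \<longleftrightarrow> k < arrivals_upto z (u + s) - arrivals_upto z s"
      unfolding arr_le_iff[OF assms(1)] by auto
    finally show ?thesis .
  qed
  \<comment> \<open>Two naturals with the same strict lower bounds are equal: test the equivalence
    at each of them.\<close>
  from this[of "arrivals_upto (residual s z) u"]
    this[of "arrivals_upto z (u + s) - arrivals_upto z s"]
  show ?thesis by linarith
qed

lemma arrivals_upto_residual_add:
  assumes "regular z" "0 \<le> u"
  shows "arrivals_upto (residual s z) u + arrivals_upto z s = arrivals_upto z (u + s)"
  using arrivals_upto_residual[OF assms] arrivals_upto_mono[OF assms(1), of s "u + s"] assms(2)
  by simp

text \<open>The flow property of restarting; it lets the recursion in \<open>fail\<close> be read as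
  consecutive windows of one configuration.\<close>

lemma residual_residual:
  assumes "regular z" "0 \<le> u"
  shows "residual u (residual s z) = residual (u + s) z"
proof
  fix k
  have *: "arrivals_upto (residual s z) u + arrivals_upto z s = arrivals_upto z (u + s)"
    by (rule arrivals_upto_residual_add[OF assms])
  show "residual u (residual s z) k = residual (u + s) z k"
  proof (cases "k = 0")
    case True
    have "residual u (residual s z) 0 = arr z (arrivals_upto z s + arrivals_upto (residual s z) u) - s - u"
      by (simp add: residual_def[of u] arr_residual)
    also have "arrivals_upto z s + arrivals_upto (residual s z) u = arrivals_upto z (u + s)"
      using * by simp
    finally show ?thesis using True by (simp add: residual_def[of "u + s"])
  next
    case False
    then have "residual u (residual s z) k = residual s z (arrivals_upto (residual s z) u + k)"
      by (simp add: residual_def[of u])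
    also have "\<dots> = z (arrivals_upto z s + (arrivals_upto (residual s z) u + k))"
      using False by (simp add: residual_def[of s])
    also have "arrivals_upto z s + (arrivals_upto (residual s z) u + k) = arrivals_upto z (u + s) + k"
      using * by simp
    finally show ?thesis using False by (simp add: residual_def[of "u + s"])
  qed
qed

text \<open>Restarting discards the points up to s and shifts the others by s. With an arbitrary
  \<open>P\<close> and bound indices, points can be moved between the two sequences without index
  arithmetic.\<close>

lemma ex_arr_residual_iff:
  assumes "regular z"
  shows "(\<exists>k. P (arr (residual s z) k)) \<longleftrightarrow> (\<exists>m. s < arr z m \<and> P (arr z m - s))"
proof
  assume "\<exists>k. P (arr (residual s z) k)"
  then obtain k where k: "P (arr z (arrivals_upto z s + k) - s)"
    by (auto simp: arr_residual)
  moreover have "s < arr z (arrivals_upto z s + k)"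
    using arr_le_iff[OF assms, of "arrivals_upto z s + k" s] by auto
  ultimately show "\<exists>m. s < arr z m \<and> P (arr z m - s)" by auto
next
  assume "\<exists>m. s < arr z m \<and> P (arr z m - s)"
  then obtain m where m: "s < arr z m" "P (arr z m - s)" by auto
  from m(1) have "arrivals_upto z s \<le> m"
    using arr_le_iff[OF assms, of m s] by auto
  then have "arr (residual s z) (m - arrivals_upto z s) = arr z m - s"
    by (simp add: arr_residual)
  with m(2) show "\<exists>k. P (arr (residual s z) k)" by metis
qed

section \<open>Configurations of all processes\<close>

definition regular_config :: "nat \<Rightarrow> (proc \<Rightarrow> nat \<Rightarrow> real) \<Rightarrow> bool" where
  "regular_config n x \<longleftrightarrow> (\<forall>k\<in>procs n. regular (x k))"

text \<open>The restriction sets values outside \<open>procs n\<close> to \<open>undefined\<close>,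
  so that restarting maps into the product space over \<open>procs n\<close>.\<close>

definition residual_config :: "nat \<Rightarrow> real \<Rightarrow> (proc \<Rightarrow> nat \<Rightarrow> real) \<Rightarrow> proc \<Rightarrow> nat \<Rightarrow> real" where
  "residual_config n s x = (\<lambda>k\<in>procs n. residual s (x k))"

lemma procs_simps [simp]:
  "Gen \<in> procs n" "Src j \<in> procs n \<longleftrightarrow> j \<in> {1..n}"
  "Gsp j i \<in> procs n \<longleftrightarrow> j \<in> {1..n} \<and> i \<in> {1..n} \<and> j \<noteq> i"
  by (auto simp: procs_def)

lemma finite_procs [simp]: "finite (procs n)"
proof -
  have "procs n \<subseteq> {Gen} \<union> Src ` {1..n} \<union> (\<lambda>(j, i). Gsp j i) ` ({1..n} \<times> {1..n})"
    by (auto simp: procs_def)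
  then show ?thesis by (rule finite_subset) auto
qed

lemma regular_configD: "regular_config n x \<Longrightarrow> k \<in> procs n \<Longrightarrow> regular (x k)"
  by (auto simp: regular_config_def)

lemma regular_residual_config: "regular_config n x \<Longrightarrow> regular_config n (residual_config n s x)"
  by (auto simp: regular_config_def residual_config_def regular_residual)

lemma residual_residual_config:
  "regular_config n x \<Longrightarrow> 0 \<le> u \<Longrightarrow>
    residual_config n u (residual_config n s x) = residual_config n (u + s) x"
  unfolding residual_config_def regular_config_def
  by (intro restrict_ext) (simp add: residual_residual)

text \<open>The rules mention only processes of the network, which allows passing between the given
  random variables and points of the product space.\<close>

lemma has_ver_cong_imp:
  assumes "\<And>k. k \<in> procs n \<Longrightarrow> x k = y k"
  assumes "has_ver n x \<delta> i t v"
  shows "has_ver n y \<delta> i t v"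
  using assms(2)
proof induction
  case (init i t)
  show ?case by (rule has_ver.init)
next
  case (from_src i m t)
  have "src_ver x = src_ver y" "x (Src i) = y (Src i)"
    using assms(1)[of Gen] assms(1)[of "Src i"] from_src
    by (auto simp: src_ver_def[abs_def])
  then show ?case using has_ver.from_src[of i n y m t \<delta>] from_src by simp
next
  case (from_gossip i j s v m t)
  have "x (Gsp j i) = y (Gsp j i)" using assms(1)[of "Gsp j i"] from_gossip by auto
  moreover have "gossiping x \<delta> j' u = gossiping y \<delta> j' u" if "j' \<in> {1..n}" for j' u
    using assms(1)[of "Src j'"] that by (simp add: gossiping_def)
  then have "delivered n x \<delta> j u = delivered n y \<delta> j u" for u
    using from_gossip(2) by (simp add: delivered_def)
  ultimately show ?case
    using from_gossip has_ver.from_gossip[of i n j y \<delta> s v m t] by simp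
qed

lemma age_cong:
  assumes "\<And>k. k \<in> procs n \<Longrightarrow> x k = y k"
  shows "age n x \<delta> i t = age n y \<delta> i t"
proof -
  have "has_ver n x \<delta> i t = has_ver n y \<delta> i t"
    using has_ver_cong_imp[of n x y] has_ver_cong_imp[of n y x] assms
    by (intro ext iffI) auto
  then show ?thesis
    using assms[of Gen] by (simp add: age_def node_ver_def src_ver_def)
qed

text \<open>A version other than 0 starts as the current one of the source and then only moves
  forward in time. The bound makes the \<open>GREATEST\<close> in \<open>node_ver\<close> an
  attained maximum.\<close>

lemma has_ver_le_src_ver:
  assumes "regular_config n x" "has_ver n x \<delta> i t v"
  shows "v \<le> arrivals_upto (x Gen) t"
  using assms(2)
proof induction
  case (from_src i m t)
  then show ?case
    using arrivals_upto_mono[OF regular_configD[OF assms(1), of Gen]] by (simp add: src_ver_eq)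
next
  case (from_gossip i j s v m t)
  then show ?case
    using arrivals_upto_mono[OF regular_configD[OF assms(1), of Gen], of s t] by simp
qed simp

lemma has_ver_node_ver:
  assumes "regular_config n x"
  shows "has_ver n x \<delta> i t (node_ver n x \<delta> i t)"
  unfolding node_ver_def
  by (rule GreatestI_nat[of _ 0 "arrivals_upto (x Gen) t"])
    (auto intro: has_ver.init has_ver_le_src_ver[OF assms])

lemma has_ver_le_node_ver:
  assumes "regular_config n x" "has_ver n x \<delta> i t v"
  shows "v \<le> node_ver n x \<delta> i t"
  unfolding node_ver_def
  by (rule Greatest_le_nat[of _ _ "arrivals_upto (x Gen) t"])
    (auto intro: assms has_ver_le_src_ver[OF assms(1)])

lemma node_ver_le: "regular_config n x \<Longrightarrow> node_ver n x \<delta> i t \<le> arrivals_upto (x Gen) t"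
  using has_ver_le_src_ver has_ver_node_ver by blast

section \<open>Gossip dynamics under restarting\<close>

text \<open>A contact at or before s no longer causes gossip from time s + \<delta> on, so for u
  \<ge> \<delta> every contact that matters survives the restart.\<close>

lemma gossiping_residual:
  assumes "regular_config n x" "j \<in> {1..n}" "\<delta> \<le> u"
  shows "gossiping (residual_config n s x) \<delta> j u \<longleftrightarrow> gossiping x \<delta> j (u + s)"
proof -
  have "gossiping (residual_config n s x) \<delta> j u \<longleftrightarrow>
      (\<exists>m. arr (residual s (x (Src j))) m \<le> u \<and> u < arr (residual s (x (Src j))) m + \<delta>)"
    using assms(2) by (simp add: gossiping_def residual_config_def)
  also have "\<dots> \<longleftrightarrow> (\<exists>m. s < arr (x (Src j)) m \<and>
      (arr (x (Src j)) m - s \<le> u \<and> u < arr (x (Src j)) m - s + \<delta>))"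
    using assms by (intro ex_arr_residual_iff regular_configD[OF assms(1)]) auto
  also have "\<dots> \<longleftrightarrow> gossiping x \<delta> j (u + s)"
    unfolding gossiping_def using assms(3) by (intro ex_cong1) auto
  finally show ?thesis .
qed

lemma delivered_residual:
  assumes "regular_config n x" "j \<in> {1..n}" "\<delta> \<le> u"
  shows "delivered n (residual_config n s x) \<delta> j u \<longleftrightarrow> delivered n x \<delta> j (u + s)"
  unfolding delivered_def using gossiping_residual[OF assms(1) _ assms(3)] assms(2) by auto

lemma arrivals_upto_less_imp_less:
  "regular z \<Longrightarrow> arrivals_upto z s < arrivals_upto z t \<Longrightarrow> s < t"
  using arrivals_upto_mono[of z t s] by force

context
  fixes n :: nat and x :: "proc \<Rightarrow> nat \<Rightarrow> real" and \<delta> s :: real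
  assumes reg: "regular_config n x" and \<delta>: "0 < \<delta>" and s: "0 \<le> s"
begin

private lemmas gen = regular_configD[OF reg procs_simps(1)]
private abbreviation (input) "x' \<equiv> residual_config n s x"
private lemmas reg' = regular_residual_config[OF reg, of s]
private lemmas gen' = regular_configD[OF reg' procs_simps(1)]

private lemma gen_add: "0 \<le> u \<Longrightarrow>
    arrivals_upto (x' Gen) u + arrivals_upto (x Gen) s = arrivals_upto (x Gen) (u + s)"
  using arrivals_upto_residual_add[OF gen] by (simp add: residual_config_def)

text \<open>A version beyond those generated by \<delta> travels only after \<delta>, where
  deliveries agree before and after restarting by \<open>delivered_residual\<close>. Its number
  shifts by the count of versions generated up to s.\<close>

lemma has_ver_residual_imp:
  assumes "has_ver n x' \<delta> i u v" "arrivals_upto (x' Gen) \<delta> < v"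
  shows "has_ver n x \<delta> i (u + s) (v + arrivals_upto (x Gen) s)"
  using assms
proof induction
  case (init i t)
  then show ?case by simp
next
  case (from_src i m t)
  let ?a = "arr (x' (Src i)) m"
  have "regular (x (Src i))" using from_src regular_configD[OF reg] by auto
  moreover have "\<exists>k. arr (residual s (x (Src i))) k = ?a"
    using from_src by (auto simp: residual_config_def)
  ultimately obtain k where k: "s < arr (x (Src i)) k" "arr (x (Src i)) k - s = ?a"
    using ex_arr_residual_iff[of "x (Src i)" "\<lambda>r. r = ?a" s] by blast
  have "src_ver x' ?a + arrivals_upto (x Gen) s = src_ver x (arr (x (Src i)) k)"
    using gen_add[of ?a] k(1) by (simp add: src_ver_eq flip: k(2))
  moreover have "has_ver n x \<delta> i (t + s) (src_ver x (arr (x (Src i)) k))"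
    using from_src k by (intro has_ver.from_src) auto
  ultimately show ?case by simp
next
  case (from_gossip i j r v m t)
  let ?a = "arr (x' (Gsp j i)) m"
  \<comment> \<open>The sender holds \<open>v\<close> at time \<open>r\<close>, so \<open>v\<close>
    had been generated by then; together with the lower bound on \<open>v\<close> this forces r >
    \<delta>.\<close>
  have "v \<le> arrivals_upto (x' Gen) r"
    using has_ver_le_src_ver[OF reg'] from_gossip by blast
  with from_gossip have "\<delta> < r" by (intro arrivals_upto_less_imp_less[OF gen']) auto
  then have a: "\<delta> < ?a" using from_gossip by simp
  have "regular (x (Gsp j i))" using from_gossip regular_configD[OF reg] by auto
  moreover have "\<exists>k. arr (residual s (x (Gsp j i))) k = ?a"
    using from_gossip by (auto simp: residual_config_def)
  ultimately obtain k where k: "s < arr (x (Gsp j i)) k" "arr (x (Gsp j i)) k - s = ?a"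
    using ex_arr_residual_iff[of "x (Gsp j i)" "\<lambda>r. r = ?a" s] by blast
  have "delivered n x \<delta> j (?a + s)"
    using from_gossip a delivered_residual[OF reg, of j \<delta> ?a s] by auto
  then have "delivered n x \<delta> j (arr (x (Gsp j i)) k)" by (simp flip: k(2))
  then show ?case
    using from_gossip k by (intro has_ver.from_gossip[of i n j x \<delta> "r + s" _ k]) auto
qed

text \<open>The converse transfer: the path of a version generated after \<delta> + s lies in the
  time range on which the two configurations have the same deliveries.\<close>

lemma has_ver_imp_residual:
  assumes "has_ver n x \<delta> i u v" "arrivals_upto (x Gen) (\<delta> + s) < v"
  shows "has_ver n x' \<delta> i (u - s) (v - arrivals_upto (x Gen) s)"
  using assms
proof induction
  case (init i t)
  then show ?case by simp
next
  case (from_src i m t)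
  let ?a = "arr (x (Src i)) m"
  have a: "\<delta> + s < ?a"
    using from_src by (intro arrivals_upto_less_imp_less[OF gen]) (simp add: src_ver_eq)
  have "regular (x (Src i))" using from_src regular_configD[OF reg] by auto
  moreover have "\<exists>m. s < arr (x (Src i)) m \<and> arr (x (Src i)) m - s = ?a - s"
    using a \<delta> by (intro exI[of _ m]) auto
  ultimately obtain k where "arr (residual s (x (Src i))) k = ?a - s"
    using ex_arr_residual_iff[of "x (Src i)" "\<lambda>r. r = ?a - s" s] by blast
  then have k: "arr (x' (Src i)) k = ?a - s" using from_src by (simp add: residual_config_def)
  have "src_ver x ?a - arrivals_upto (x Gen) s = src_ver x' (?a - s)"
    using gen_add[of "?a - s"] a \<delta> by (simp add: src_ver_eq)
  moreover have "has_ver n x' \<delta> i (t - s) (src_ver x' (arr (x' (Src i)) k))"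
    using from_src k by (intro has_ver.from_src) auto
  ultimately show ?case using k by simp
next
  case (from_gossip i j r v m t)
  let ?a = "arr (x (Gsp j i)) m"
  have "v \<le> arrivals_upto (x Gen) r"
    using has_ver_le_src_ver[OF reg] from_gossip by blast
  with from_gossip have "\<delta> + s < r" by (intro arrivals_upto_less_imp_less[OF gen]) auto
  then have a: "\<delta> + s < ?a" using from_gossip by simp
  have "regular (x (Gsp j i))" using from_gossip regular_configD[OF reg] by auto
  moreover have "\<exists>m. s < arr (x (Gsp j i)) m \<and> arr (x (Gsp j i)) m - s = ?a - s"
    using a \<delta> by (intro exI[of _ m]) auto
  ultimately obtain k where "arr (residual s (x (Gsp j i))) k = ?a - s"
    using ex_arr_residual_iff[of "x (Gsp j i)" "\<lambda>r. r = ?a - s" s] by blast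
  then have k: "arr (x' (Gsp j i)) k = ?a - s" using from_gossip by (simp add: residual_config_def)
  have "delivered n x' \<delta> j (?a - s)"
    using from_gossip a delivered_residual[OF reg, of j \<delta> "?a - s" s] by auto
  then show ?case
    using from_gossip k by (intro has_ver.from_gossip[of i n j x' \<delta> "r - s" _ k]) auto
qed

end

section \<open>The truncated age\<close>

definition trunc_age ::
  "nat \<Rightarrow> real \<Rightarrow> nat \<Rightarrow> real \<Rightarrow> real \<Rightarrow> (proc \<Rightarrow> nat \<Rightarrow> real) \<Rightarrow> real" where
  "trunc_age n \<delta> i a t x = min (age n x \<delta> i t) (real (src_ver x t) - real (src_ver x a))"

text \<open>Truncation amounts to granting the node all versions generated up to a.\<close>

lemma trunc_age_eq:
  "trunc_age n \<delta> i a t x =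
    real (arrivals_upto (x Gen) t) - real (max (node_ver n x \<delta> i t) (arrivals_upto (x Gen) a))"
  by (auto simp: trunc_age_def age_def src_ver_eq max_def)

text \<open>Only versions beyond the count at a \<ge> \<delta> affect the maximum in
  \<open>trunc_age_eq\<close>, and for these possession transfers in both directions.\<close>

lemma trunc_age_residual:
  assumes reg: "regular_config n x" and \<delta>: "0 < \<delta>" "\<delta> \<le> a" "a \<le> t" "0 \<le> s"
  shows "trunc_age n \<delta> i a t (residual_config n s x) = trunc_age n \<delta> i (a + s) (t + s) x"
proof -
  define x' where "x' = residual_config n s x"
  define N where "N = arrivals_upto (x Gen)"
  define N' where "N' = arrivals_upto (x' Gen)"
  define v where "v = node_ver n x \<delta> i (t + s)"
  define v' where "v' = node_ver n x' \<delta> i t"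
  have gen: "regular (x Gen)" using regular_configD[OF reg] by simp
  have reg': "regular_config n x'" unfolding x'_def by (rule regular_residual_config[OF reg])
  have add: "N' u + N s = N (u + s)" if "0 \<le> u" for u
    using arrivals_upto_residual_add[OF gen that, of s]
    by (simp add: N_def N'_def x'_def residual_config_def)
  have N_mono: "N (\<delta> + s) \<le> N (a + s)"
    unfolding N_def using \<delta> by (intro arrivals_upto_mono[OF gen]) auto
  have N'_mono: "N' \<delta> \<le> N' a"
    using N_mono add[of \<delta>] add[of a] \<delta> by linarith
  have 1: "v - N s \<le> v'" if "N (a + s) < v"
  proof -
    have "has_ver n x' \<delta> i (t + s - s) (v - N s)"
      unfolding x'_def N_def
      by (rule has_ver_imp_residual[OF reg \<delta>(1) \<delta>(4)])
        (use that N_mono has_ver_node_ver[OF reg, of \<delta> i "t + s"] in \<open>auto simp: N_def v_def\<close>)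
    then show ?thesis unfolding v'_def by (intro has_ver_le_node_ver[OF reg']) simp
  qed
  have 2: "v' + N s \<le> v" if "N' a < v'"
  proof -
    have "has_ver n x \<delta> i (t + s) (v' + N s)"
      unfolding N_def
      by (rule has_ver_residual_imp[OF reg \<delta>(1) \<delta>(4)])
        (use that N'_mono has_ver_node_ver[OF reg', of \<delta> i t] in \<open>auto simp: N'_def v'_def x'_def\<close>)
    then show ?thesis unfolding v_def by (rule has_ver_le_node_ver[OF reg])
  qed
  \<comment> \<open>Where a node version does not exceed the truncation count, the count itself is
    the maximum, so facts 1 and 2 suffice.\<close>
  have "max v (N (a + s)) = max v' (N' a) + N s"
    using 1 2 add[of a] \<delta> by linarith
  moreover have "N (t + s) = N' t + N s" using add[of t] \<delta> by simp
  ultimately have "real (N' t) - real (max v' (N' a)) = real (N (t + s)) - real (max v (N (a + s)))"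
    by simp
  then show ?thesis
    unfolding trunc_age_eq N_def N'_def v_def v'_def x'_def .
qed

section \<open>Successful windows and runs of failures\<close>

text \<open>Ranges for the first arrivals in a window of length \<open>2\<delta>\<close> under which node j alone is contacted and then
  delivers to i: at the time of the tick of \<open>Gsp j i\<close>, contacts from before the window no longer matter,
  and j is still gossiping.\<close>

definition first_contact :: "nat \<Rightarrow> real \<Rightarrow> nat \<Rightarrow> nat \<Rightarrow> proc \<Rightarrow> real set" where
  "first_contact n \<delta> i j k = (case k of
      Gen \<Rightarrow> UNIV
    | Src j' \<Rightarrow> if j' = j then {\<delta><..3/2 * \<delta>} else {2 * \<delta><..}
    | Gsp j' i' \<Rightarrow> if j' = j \<and> i' = i then {3/2 * \<delta><..7/4 * \<delta>} else UNIV)"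

text \<open>For each j this is a rectangle in the first arrivals, so its probability is a product
  over the processes.\<close>

definition success :: "nat \<Rightarrow> real \<Rightarrow> nat \<Rightarrow> (proc \<Rightarrow> nat \<Rightarrow> real) \<Rightarrow> bool" where
  "success n \<delta> i x \<longleftrightarrow> (\<exists>j\<in>{1..n} - {i}. \<forall>k\<in>procs n. x k 0 \<in> first_contact n \<delta> i j k)"

text \<open>The recursion restarts at the end of the first window, so that each step of the
  probability bound applies the restart law once.\<close>

primrec fail :: "nat \<Rightarrow> real \<Rightarrow> nat \<Rightarrow> nat \<Rightarrow> (proc \<Rightarrow> nat \<Rightarrow> real) \<Rightarrow> bool" where
  "fail n \<delta> i 0 x \<longleftrightarrow> True"
| "fail n \<delta> i (Suc l) x \<longleftrightarrow> \<not> success n \<delta> i x \<and> fail n \<delta> i l (residual_config n (2 * \<delta>) x)"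

text \<open>Node j, contacted more than \<delta> after b and before the tick of
  \<open>Gsp j i\<close>, is still gossiping at the tick, and alone; it passes on a version at least
  as new as the count at b.\<close>

lemma success_imp_node_ver:
  assumes reg: "regular_config n x" and \<delta>: "0 < \<delta>" and i: "i \<in> {1..n}" and b: "0 \<le> b"
    and succ: "success n \<delta> i (residual_config n b x)" and t: "b + 2 * \<delta> \<le> t"
  shows "arrivals_upto (x Gen) b \<le> node_ver n x \<delta> i t"
proof -
  from succ obtain j where j: "j \<in> {1..n}" "j \<noteq> i"
    and *: "\<And>k. k \<in> procs n \<Longrightarrow> residual b (x k) 0 \<in> first_contact n \<delta> i j k"
    unfolding success_def residual_config_def
    by (metis DiffD1 DiffD2 restrict_apply' singletonI)
  define N where "N k = arrivals_upto (x k) b" for k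
  have first: "arr (x k) (N k) - b \<in> first_contact n \<delta> i j k" if "k \<in> procs n" for k
    using *[OF that] by (simp add: residual_def N_def)
  let ?a = "arr (x (Src j)) (N (Src j))" and ?g = "arr (x (Gsp j i)) (N (Gsp j i))"
  have a: "b + \<delta> \<le> ?a" "?a \<le> b + 3/2 * \<delta>"
    using first[of "Src j"] j by (auto simp: first_contact_def)
  have g: "b + 3/2 * \<delta> < ?g" "?g < b + 2 * \<delta>"
    using first[of "Gsp j i"] i j \<delta> by (auto simp: first_contact_def)
  have "gossiping x \<delta> j ?g"
    unfolding gossiping_def using a g by (intro exI[of _ "N (Src j)"]) auto
  \<comment> \<open>A disturbing contact lies less than \<delta> before the tick, hence after b. It
    is then no earlier than the first contact of that node after b, which comes only after the
    window.\<close>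
  moreover have "\<not> gossiping x \<delta> j' ?g" if j': "j' \<in> {1..n}" "j' \<noteq> j" for j'
  proof
    assume "gossiping x \<delta> j' ?g"
    then obtain m where m: "arr (x (Src j')) m \<le> ?g" "?g < arr (x (Src j')) m + \<delta>"
      by (auto simp: gossiping_def)
    have r: "regular (x (Src j'))" using j' regular_configD[OF reg] by auto
    have "b < arr (x (Src j')) m" using m g \<delta> by auto
    then have "N (Src j') \<le> m" using arr_le_iff[OF r, of m b] by (auto simp: N_def)
    then have "arr (x (Src j')) (N (Src j')) \<le> arr (x (Src j')) m"
      using arr_strict_mono[OF r] by (simp add: strict_mono_less_eq)
    moreover have "b + 2 * \<delta> < arr (x (Src j')) (N (Src j'))"
      using first[of "Src j'"] j' by (auto simp: first_contact_def)
    ultimately show False using m g by simp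
  qed
  ultimately have "delivered n x \<delta> j ?g" by (auto simp: delivered_def)
  moreover have "has_ver n x \<delta> j ?a (src_ver x ?a)"
    using j by (intro has_ver.from_src) auto
  ultimately have "has_ver n x \<delta> i t (src_ver x ?a)"
    using i j a g t by (intro has_ver.from_gossip[of i n j x \<delta> ?a _ "N (Gsp j i)"]) auto
  then have "src_ver x ?a \<le> node_ver n x \<delta> i t" by (rule has_ver_le_node_ver[OF reg])
  moreover have "arrivals_upto (x Gen) b \<le> src_ver x ?a"
    unfolding src_ver_eq using a \<delta> regular_configD[OF reg] by (intro arrivals_upto_mono) auto
  ultimately show ?thesis by simp
qed

text \<open>The first successful window among the \<open>l\<close> starts no earlier than b and ends
  by t, and success there delivers at least the version current at its start. For
  \<open>l = 0\<close> the premise is contradictory, since \<open>fail\<close> holds.\<close>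

lemma not_fail_imp_node_ver:
  assumes reg: "regular_config n x" and \<delta>: "0 < \<delta>" and i: "i \<in> {1..n}"
  shows "0 \<le> b \<Longrightarrow> \<not> fail n \<delta> i l (residual_config n b x) \<Longrightarrow> b + real l * (2 * \<delta>) \<le> t \<Longrightarrow>
    arrivals_upto (x Gen) b \<le> node_ver n x \<delta> i t"
proof (induction l arbitrary: b)
  case (Suc l)
  show ?case
  proof (cases "success n \<delta> i (residual_config n b x)")
    case True
    have "0 \<le> real l * (2 * \<delta>)" using \<delta> by simp
    then have "b + 2 * \<delta> \<le> t" using Suc.prems(3) by (simp add: algebra_simps)
    then show ?thesis by (rule success_imp_node_ver[OF reg \<delta> i Suc.prems(1) True])
  next
    case False
    then have "\<not> fail n \<delta> i l (residual_config n (2 * \<delta> + b) x)"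
      using Suc.prems \<delta> by (simp add: residual_residual_config[OF reg])
    then have "arrivals_upto (x Gen) (2 * \<delta> + b) \<le> node_ver n x \<delta> i t"
      using Suc.prems \<delta> by (intro Suc.IH) (auto simp: algebra_simps)
    moreover have "arrivals_upto (x Gen) b \<le> arrivals_upto (x Gen) (2 * \<delta> + b)"
      using \<delta> regular_configD[OF reg] by (intro arrivals_upto_mono) auto
    ultimately show ?thesis by simp
  qed
qed simp

section \<open>Effect of moving the truncation point\<close>

lemma trunc_age_nonneg:
  assumes "regular_config n x" "a \<le> t"
  shows "0 \<le> trunc_age n \<delta> i a t x"
  using node_ver_le[OF assms(1), of \<delta> i t]
    arrivals_upto_mono[OF regular_configD[OF assms(1), of Gen] assms(2)]
  by (simp add: trunc_age_eq)

lemma trunc_age_antimono: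
  assumes "regular_config n x" "a \<le> b"
  shows "trunc_age n \<delta> i b t x \<le> trunc_age n \<delta> i a t x"
  using arrivals_upto_mono[OF regular_configD[OF assms(1), of Gen] assms(2)]
  by (auto simp: trunc_age_eq)

lemma trunc_age_0:
  "regular_config n x \<Longrightarrow> trunc_age n \<delta> i 0 t x = age n x \<delta> i t"
  using arrivals_upto_0[OF regular_configD[of n x Gen]]
  by (simp add: trunc_age_eq age_def src_ver_eq)

text \<open>After a success between b and t the node holds a version at least as new as the count at
  b, and both truncations are the plain age. Otherwise they differ by at most the versions generated
  between a and b.\<close>

lemma trunc_age_le:
  assumes reg: "regular_config n x" and \<delta>: "0 < \<delta>" and i: "i \<in> {1..n}"
    and ab: "0 \<le> a" "a \<le> b" "b + real l * (2 * \<delta>) \<le> t"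
  shows "trunc_age n \<delta> i a t x \<le> trunc_age n \<delta> i b t x +
    real (arrivals_upto (x Gen) b - arrivals_upto (x Gen) a) *
      of_bool (fail n \<delta> i l (residual_config n b x))"
proof (cases "fail n \<delta> i l (residual_config n b x)")
  case True
  then show ?thesis
    using arrivals_upto_mono[OF regular_configD[OF reg, of Gen] ab(2)] by (auto simp: trunc_age_eq)
next
  case False
  have "arrivals_upto (x Gen) b \<le> node_ver n x \<delta> i t"
    using not_fail_imp_node_ver[OF reg \<delta> i _ False ab(3)] ab by auto
  then show ?thesis
    using False arrivals_upto_mono[OF regular_configD[OF reg, of Gen] ab(2)]
    by (simp add: trunc_age_eq)
qed

text \<open>\<open>first_contact\<close> leaves \<open>Gen\<close> unconstrained, so failure
  concerns contacts and gossip ticks alone. This will give its independence of version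
  generation.\<close>

lemma fail_cong:
  "(\<And>k. k \<noteq> Gen \<Longrightarrow> x k = y k) \<Longrightarrow> fail n \<delta> i l x \<longleftrightarrow> fail n \<delta> i l y"
proof (induction l arbitrary: x y)
  case (Suc l)
  have "x k 0 \<in> first_contact n \<delta> i j k \<longleftrightarrow> y k 0 \<in> first_contact n \<delta> i j k" for j k
    using Suc.prems by (cases "k = Gen") (auto simp: first_contact_def)
  then have "success n \<delta> i x = success n \<delta> i y" by (simp add: success_def)
  moreover have "fail n \<delta> i l (residual_config n (2 * \<delta>) x) = fail n \<delta> i l (residual_config n (2 * \<delta>) y)"
    using Suc.prems by (intro Suc.IH) (auto simp: residual_config_def restrict_def)
  ultimately show ?case by simp
qed simp

section \<open>Sequences of exponential interarrival times\<close>

abbreviation seq_borel :: "(nat \<Rightarrow> real) measure" where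
  "seq_borel \<equiv> PiM UNIV (\<lambda>_. borel)"

definition exp_measure :: "real \<Rightarrow> real measure" where
  "exp_measure r = density lborel (exponential_density r)"

definition exp_seq :: "real \<Rightarrow> (nat \<Rightarrow> real) measure" where
  "exp_seq r = PiM UNIV (\<lambda>_. exp_measure r)"

lemma sets_exp_measure [simp, measurable_cong]: "sets (exp_measure r) = sets borel"
  by (simp add: exp_measure_def)

lemma space_exp_measure [simp]: "space (exp_measure r) = UNIV"
  by (simp add: exp_measure_def)

lemma sets_exp_seq [simp, measurable_cong]: "sets (exp_seq r) = sets seq_borel"
  unfolding exp_seq_def by (intro sets_PiM_cong) auto

lemma space_exp_seq [simp]: "space (exp_seq r) = UNIV"
  by (simp add: exp_seq_def space_PiM)

lemma measurable_arr [measurable]: "(\<lambda>z. arr z m) \<in> borel_measurable seq_borel"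
  unfolding arr_def by measurable

lemma measurable_arrivals_upto [measurable]:
  "(\<lambda>z. arrivals_upto z t) \<in> measurable seq_borel (count_space UNIV)"
  unfolding arrivals_upto_def by measurable

lemma measurable_residual [measurable]: "residual t \<in> measurable seq_borel seq_borel"
proof (rule measurable_PiM_single')
  show "(\<lambda>z. residual t z k) \<in> borel_measurable seq_borel" for k
    unfolding residual_def
    \<comment> \<open>The number of arrivals is a random index; measurability is checked for each
      fixed value \<open>N\<close> of it.\<close>
    by (rule measurable_compose_countable[OF _ measurable_arrivals_upto,
          where f = "\<lambda>N z. if k = 0 then arr z N - t else z (N + k)"])
      measurable
qed (auto simp: space_PiM)

lemma measurable_case_nat_seq [measurable]:
  "(\<lambda>(a, z). case_nat a z) \<in> measurable (borel \<Otimes>\<^sub>M seq_borel) seq_borel"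
proof (rule measurable_PiM_single')
  show "(\<lambda>p. (case p of (a, z) \<Rightarrow> case_nat a z) k) \<in> borel_measurable (borel \<Otimes>\<^sub>M seq_borel)" for k
    by (cases k) (simp_all add: split_beta')
qed (auto simp: space_PiM)

text \<open>This is the sequence restarted at t in the case of exactly \<open>m\<close> arrivals up
  to t.\<close>

lemma measurable_residual_on:
  "(\<lambda>z. case_nat (arr z m - t) (\<lambda>k. z (Suc (m + k)))) \<in> measurable seq_borel seq_borel"
proof (rule measurable_PiM_single')
  show "(\<lambda>z. case_nat (arr z m - t) (\<lambda>k. z (Suc (m + k))) l) \<in> borel_measurable seq_borel" for l
    by (cases l) simp_all
qed (auto simp: space_PiM)

section \<open>First-arrival decomposition of restarting\<close>

lemma residual_case_nat_le:
  assumes "regular z" "a \<le> w"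
  shows "residual w (case_nat a z) = residual (w - a) z"
proof -
  have "{m. arr (case_nat a z) m \<le> w} = insert 0 (Suc ` {m. arr z m \<le> w - a})" (is "?L = ?R")
  proof (rule set_eqI)
    fix m show "m \<in> ?L \<longleftrightarrow> m \<in> ?R"
      using assms(2) by (cases m) (auto simp: arr_case_nat_0 arr_case_nat_Suc)
  qed
  moreover have "finite {m. arr z m \<le> w - a}" using arr_le_iff[OF assms(1)] by simp
  ultimately have *: "arrivals_upto (case_nat a z) w = Suc (arrivals_upto z (w - a))"
    by (simp add: arrivals_upto_def card_image)
  show ?thesis
    by (rule ext) (simp add: residual_def * arr_case_nat_Suc)
qed

lemma residual_case_nat_gt:
  assumes "regular z" "w < a"
  shows "residual w (case_nat a z) = case_nat (a - w) z"
proof -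
  have "{m. arr (case_nat a z) m \<le> w} = {}"
  proof safe
    fix m assume "arr (case_nat a z) m \<le> w"
    then show "m \<in> {}"
      using assms(2) arr_pos[OF assms(1), of "m - 1"]
      by (cases m) (auto simp: arr_case_nat_0 arr_case_nat_Suc)
  qed
  then have *: "arrivals_upto (case_nat a z) w = 0"
    by (simp add: arrivals_upto_def)
  show ?thesis
    by (rule ext) (simp add: residual_def * arr_case_nat_0 split: nat.split)
qed

section \<open>Exponential gaps and non-explosion\<close>

context
  fixes r :: real
  assumes r: "0 < r"
begin

interpretation E: prob_space "exp_measure r"
  unfolding exp_measure_def by (rule prob_space_exponential_density[OF r])

interpretation sequence_space "exp_measure r"
  by unfold_locales

lemma prob_space_exp_measure: "prob_space (exp_measure r)"
  by (rule E.prob_space_axioms)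

lemma prob_space_exp_seq: "prob_space (exp_seq r)"
  unfolding exp_seq_def by (rule P.prob_space_axioms)

interpretation S: prob_space "exp_seq r"
  by (rule prob_space_exp_seq)

text \<open>The infinite product is one factor times a copy of itself. Conditioning on the first gap
  in this way drives the inductions over arrivals.\<close>

lemma nn_integral_exp_seq:
  assumes [measurable]: "f \<in> borel_measurable seq_borel"
  shows "(\<integral>\<^sup>+z. f z \<partial>exp_seq r) = (\<integral>\<^sup>+a. \<integral>\<^sup>+z. f (case_nat a z) \<partial>exp_seq r \<partial>exp_measure r)"
proof -
  have "(\<integral>\<^sup>+z. f z \<partial>exp_seq r) =
      (\<integral>\<^sup>+z. f z \<partial>distr (exp_measure r \<Otimes>\<^sub>M exp_seq r) (exp_seq r) (\<lambda>(a, z). case_nat a z))"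
    unfolding exp_seq_def by (subst PiM_iter) simp
  also have "\<dots> = (\<integral>\<^sup>+p. f (case p of (a, z) \<Rightarrow> case_nat a z) \<partial>(exp_measure r \<Otimes>\<^sub>M exp_seq r))"
    by (rule nn_integral_distr) measurable
  also have "\<dots> = (\<integral>\<^sup>+a. \<integral>\<^sup>+z. f (case_nat a z) \<partial>exp_seq r \<partial>exp_measure r)"
    by (subst S.nn_integral_fst[symmetric]) auto
  finally show ?thesis .
qed

text \<open>Memorylessness for a test function of the overshoot: shifting by t multiplies the
  density by \<open>exp (- r * t)\<close>.\<close>

lemma exp_memoryless:
  assumes [measurable]: "g \<in> borel_measurable borel" and t: "0 \<le> t"
  shows "(\<integral>\<^sup>+a. indicator {t<..} a * g (a - t) \<partial>exp_measure r) =
    ennreal (exp (- r * t)) * (\<integral>\<^sup>+a. g a \<partial>exp_measure r)"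
proof -
  have "(\<integral>\<^sup>+a. indicator {t<..} a * g (a - t) \<partial>exp_measure r) =
      (\<integral>\<^sup>+a. ennreal (exponential_density r a) * (indicator {t<..} a * g (a - t)) \<partial>lborel)"
    unfolding exp_measure_def by (subst nn_integral_density) auto
  also have "\<dots> = (\<integral>\<^sup>+a. ennreal (exponential_density r (t + 1 * a)) *
      (indicator {t<..} (t + 1 * a) * g (t + 1 * a - t)) \<partial>lborel)"
    by (subst nn_integral_real_affine[where c = 1 and t = t]) auto
  also have "\<dots> = (\<integral>\<^sup>+a. ennreal (exp (- r * t)) * (ennreal (exponential_density r a) * g a) \<partial>lborel)"
  proof (rule nn_integral_cong_AE)
    \<comment> \<open>At a = 0 the strict indicator vanishes while the density does not, so the two
      integrands may differ at this point.\<close>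
    have "AE a in lborel. a \<noteq> (0::real)" by (rule AE_lborel_singleton)
    then show "AE a in lborel. ennreal (exponential_density r (t + 1 * a)) *
        (indicator {t<..} (t + 1 * a) * g (t + 1 * a - t)) =
        ennreal (exp (- r * t)) * (ennreal (exponential_density r a) * g a)"
    proof eventually_elim
      case (elim a)
      show ?case
      proof (cases "a < 0")
        case False
        then have "exponential_density r (t + a) = exp (- r * t) * exponential_density r a"
          using t by (simp add: exponential_density_def algebra_simps flip: exp_add)
        then show ?thesis using False elim
          by (simp add: ennreal_mult' mult.assoc)
      qed (simp add: exponential_density_def)
    qed
  qed
  also have "\<dots> = ennreal (exp (- r * t)) * (\<integral>\<^sup>+a. ennreal (exponential_density r a) * g a \<partial>lborel)"
    by (rule nn_integral_cmult) auto
  also have "(\<integral>\<^sup>+a. ennreal (exponential_density r a) * g a \<partial>lborel) = (\<integral>\<^sup>+a. g a \<partial>exp_measure r)"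
    unfolding exp_measure_def by (subst nn_integral_density) auto
  finally show ?thesis .
qed

lemma emeasure_exp_gt: "0 \<le> t \<Longrightarrow> emeasure (exp_measure r) {t<..} = ennreal (exp (- r * t))"
  using exp_memoryless[of "\<lambda>_. 1" t] E.emeasure_space_1 by simp

lemma measure_exp_gt: "0 \<le> t \<Longrightarrow> measure (exp_measure r) {t<..} = exp (- r * t)"
  using emeasure_exp_gt by (simp add: E.emeasure_eq_measure)

lemma measure_exp_interval:
  assumes "0 \<le> a" "a \<le> b"
  shows "measure (exp_measure r) {a<..b} = exp (- r * a) - exp (- r * b)"
proof -
  have "{a<..b} = {a<..} - {b<..}" by auto
  then have "measure (exp_measure r) {a<..b} = measure (exp_measure r) {a<..} - measure (exp_measure r) {b<..}"
    using assms by (simp add: E.finite_measure_Diff)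
  then show ?thesis using assms by (simp add: measure_exp_gt)
qed

lemma AE_exp_pos: "AE a in exp_measure r. 0 < a"
proof -
  have "AE a in lborel. a \<noteq> (0::real)" by (rule AE_lborel_singleton)
  then have "AE a in lborel. 0 < ennreal (exponential_density r a) \<longrightarrow> 0 < a"
    by eventually_elim (auto simp: exponential_density_def not_less)
  then show ?thesis unfolding exp_measure_def by (subst AE_density) auto
qed

text \<open>Laplace transform at 1: weighting the density of rate r by \<open>exp (- a)\<close>
  gives a multiple of the density of rate r + 1.\<close>

lemma nn_integral_exp_Laplace:
  "(\<integral>\<^sup>+a. ennreal (exp (- a)) \<partial>exp_measure r) = ennreal (r / (r + 1))"
proof -
  have "(\<integral>\<^sup>+a. ennreal (exp (- a)) \<partial>exp_measure r) =
      (\<integral>\<^sup>+a. ennreal (exponential_density r a) * ennreal (exp (- a)) \<partial>lborel)"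
    unfolding exp_measure_def by (subst nn_integral_density) auto
  also have "\<dots> = (\<integral>\<^sup>+a. ennreal (r / (r + 1)) * ennreal (exponential_density (r + 1) a) \<partial>lborel)"
  proof (rule nn_integral_cong)
    fix a :: real
    have "exponential_density r a * exp (- a) = r / (r + 1) * exponential_density (r + 1) a"
    proof -
      have "r / (r + 1) * exponential_density (r + 1) a = (if a < 0 then 0 else r * exp (- a * (r + 1)))"
        using r by (simp add: exponential_density_def)
      then show ?thesis by (simp add: exponential_density_def algebra_simps flip: exp_add)
    qed
    then show "ennreal (exponential_density r a) * ennreal (exp (- a)) =
        ennreal (r / (r + 1)) * ennreal (exponential_density (r + 1) a)"
      using r by (simp flip: ennreal_mult' ennreal_mult'')
  qed
  also have "\<dots> = ennreal (r / (r + 1)) * (\<integral>\<^sup>+a. ennreal (exponential_density (r + 1) a) \<partial>lborel)"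
    by (rule nn_integral_cmult) auto
  also have "(\<integral>\<^sup>+a. ennreal (exponential_density (r + 1) a) \<partial>lborel) = 1"
    using prob_space.emeasure_space_1[OF prob_space_exponential_density[of "r + 1"]] r
    by (simp add: emeasure_density)
  finally show ?thesis by simp
qed

lemma nn_integral_exp_arr:
  "(\<integral>\<^sup>+z. ennreal (exp (- arr z m)) \<partial>exp_seq r) = ennreal (r / (r + 1)) ^ Suc m"
proof (induction m)
  case 0
  show ?case
    by (subst nn_integral_exp_seq) (simp_all add: arr_case_nat_0 nn_integral_exp_Laplace S.emeasure_space_1[simplified])
next
  case (Suc m)
  have "(\<integral>\<^sup>+z. ennreal (exp (- arr z (Suc m))) \<partial>exp_seq r) =
      (\<integral>\<^sup>+a. \<integral>\<^sup>+z. ennreal (exp (- a)) * ennreal (exp (- arr z m)) \<partial>exp_seq r \<partial>exp_measure r)"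
    by (subst nn_integral_exp_seq)
      (simp_all add: arr_case_nat_Suc exp_diff exp_minus field_simps flip: ennreal_mult)
  also have "\<dots> = (\<integral>\<^sup>+a. ennreal (exp (- a)) * ennreal (r / (r + 1)) ^ Suc m \<partial>exp_measure r)"
    by (intro nn_integral_cong) (subst nn_integral_cmult, auto simp: Suc)
  also have "\<dots> = (\<integral>\<^sup>+a. ennreal (exp (- a)) \<partial>exp_measure r) * ennreal (r / (r + 1)) ^ Suc m"
    by (rule nn_integral_multc) measurable
  also have "\<dots> = ennreal (r / (r + 1)) ^ Suc (Suc m)"
    unfolding nn_integral_exp_Laplace by (rule power_Suc[symmetric])
  finally show ?case .
qed

text \<open>Chernoff bound: the indicator of an arrival by t is at most
  \<open>exp (t - arr z m)\<close>, whose means form a geometric series. This gives non-explosion as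
  well as finite mean counts.\<close>

lemma nn_integral_sum_arrivals_finite:
  "(\<integral>\<^sup>+z. (\<Sum>m. indicator {..t} (arr z m)) \<partial>exp_seq r) < \<infinity>"
proof -
  let ?c = "r / (r + 1)"
  have c: "0 < ?c" "?c < 1" using r by auto
  have "(\<integral>\<^sup>+z. (\<Sum>m. indicator {..t} (arr z m)) \<partial>exp_seq r) =
      (\<Sum>m. \<integral>\<^sup>+z. indicator {..t} (arr z m) \<partial>exp_seq r)"
    by (rule nn_integral_suminf) measurable
  also have "\<dots> \<le> (\<Sum>m. ennreal (exp t * ?c ^ Suc m))"
  proof (intro suminf_le summableI)
    fix m
    have "(\<integral>\<^sup>+z. indicator {..t} (arr z m) \<partial>exp_seq r) \<le>
        (\<integral>\<^sup>+z. ennreal (exp t) * ennreal (exp (- arr z m)) \<partial>exp_seq r)"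
      by (intro nn_integral_mono)
        (auto simp: indicator_def mult_exp_exp simp flip: ennreal_mult intro!: ennreal_leI)
    also have "\<dots> = ennreal (exp t) * ennreal ?c ^ Suc m"
      by (subst nn_integral_cmult) (auto simp: nn_integral_exp_arr)
    also have "\<dots> = ennreal (exp t * ?c ^ Suc m)"
      using c by (simp add: ennreal_power ennreal_mult del: power_Suc)
    finally show "(\<integral>\<^sup>+z. indicator {..t} (arr z m) \<partial>exp_seq r) \<le> ennreal (exp t * ?c ^ Suc m)" .
  qed
  also have "\<dots> < \<infinity>"
  proof -
    have "norm ?c < 1" using c by (simp only: real_norm_def abs_of_pos)
    then have "summable (\<lambda>m. ?c ^ m)" by (rule summable_geometric)
    then have "summable (\<lambda>m. (exp t * ?c) * ?c ^ m)" by (rule summable_mult)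
    then have "summable (\<lambda>m. exp t * ?c ^ Suc m)" by (simp add: mult.assoc)
    moreover have "0 \<le> exp t * ?c ^ Suc m" for m
      using c by (intro mult_nonneg_nonneg zero_le_power less_imp_le) auto
    ultimately have "(\<Sum>m. ennreal (exp t * ?c ^ Suc m)) = ennreal (\<Sum>m. exp t * ?c ^ Suc m)"
      by (intro suminf_ennreal2)
    then show ?thesis by simp
  qed
  finally show ?thesis .
qed

lemma AE_regular: "AE z in exp_seq r. regular z"
proof -
  have "AE z in exp_seq r. \<forall>m. 0 < z m"
    unfolding AE_all_countable exp_seq_def
    by (intro allI AE_PiM_component[where P = "\<lambda>a. 0 < a"] AE_exp_pos) (auto intro: prob_space_exp_measure)
  \<comment> \<open>Integer times suffice, and there are only countably many of them, as an almost
    sure statement for all of them requires.\<close>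
  moreover have "AE z in exp_seq r. \<forall>t::nat. \<exists>m. real t < arr z m"
    unfolding AE_all_countable
  proof
    fix t :: nat
    have "AE z in exp_seq r. (\<Sum>m. indicator {..real t} (arr z m) :: ennreal) \<noteq> \<infinity>"
      using nn_integral_sum_arrivals_finite[of "real t"] by (intro nn_integral_PInf_AE) auto
    then show "AE z in exp_seq r. \<exists>m. real t < arr z m"
    proof eventually_elim
      case (elim z)
      show ?case
      proof (rule ccontr)
        assume "\<nexists>m. real t < arr z m"
        \<comment> \<open>Without an arrival beyond t all terms equal one, contradicting the finite
          sum.\<close>
        then have "(\<lambda>m. indicator {..real t} (arr z m) :: ennreal) = (\<lambda>_. 1)"
          by (auto simp: not_less fun_eq_iff)
        moreover have "(\<Sum>m::nat. 1 :: ennreal) = \<infinity>"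
          by (simp add: suminf_eq_SUP ennreal_SUP_of_nat_eq_top)
        ultimately show False using elim by simp
      qed
    qed
  qed
  ultimately show ?thesis
  proof eventually_elim
    case (elim z)
    have "\<exists>m. t < arr z m" for t
    proof -
      obtain k :: nat where "t < real k" using reals_Archimedean2 by blast
      with elim show ?thesis by (meson order_less_trans)
    qed
    with elim show ?case by (auto simp: regular_def)
  qed
qed

section \<open>Markov property at a fixed time\<close>

text \<open>Induction on the number \<open>m\<close> of arrivals up to t. Conditioning on the first
  gap a leaves one arrival fewer within time t - a; without arrivals memorylessness applies.\<close>

lemma nn_integral_residual_on:
  assumes [measurable]: "h \<in> borel_measurable seq_borel" and "0 \<le> t"
  shows "(\<integral>\<^sup>+z. of_bool ((\<forall>l<m. arr z l \<le> t) \<and> t < arr z m) *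
        h (case_nat (arr z m - t) (\<lambda>k. z (Suc (m + k)))) \<partial>exp_seq r) =
    (\<integral>\<^sup>+z. of_bool ((\<forall>l<m. arr z l \<le> t) \<and> t < arr z m) \<partial>exp_seq r) * (\<integral>\<^sup>+z. h z \<partial>exp_seq r)"
  using assms(2)
proof (induction m arbitrary: t)
  case 0
  have [measurable]: "(\<lambda>z. h (case_nat (z 0 - t) (\<lambda>k. z (Suc k)))) \<in> borel_measurable seq_borel"
    using measurable_compose[OF measurable_residual_on[of 0 t] assms(1)] by (simp only: arr_0 add_0)
  define g where "g a = (\<integral>\<^sup>+z. h (case_nat a z) \<partial>exp_seq r)" for a
  have [measurable]: "g \<in> borel_measurable borel"
    unfolding g_def by measurable
  have "(\<integral>\<^sup>+z. of_bool (t < z 0) * h (case_nat (z 0 - t) (\<lambda>k. z (Suc k))) \<partial>exp_seq r) =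
      (\<integral>\<^sup>+a. \<integral>\<^sup>+z. of_bool (t < a) * h (case_nat (a - t) z) \<partial>exp_seq r \<partial>exp_measure r)"
    by (subst nn_integral_exp_seq) auto
  also have "\<dots> = (\<integral>\<^sup>+a. indicator {t<..} a * g (a - t) \<partial>exp_measure r)"
    unfolding g_def by (intro nn_integral_cong) (auto simp: indicator_def)
  also have "\<dots> = ennreal (exp (- r * t)) * (\<integral>\<^sup>+a. g a \<partial>exp_measure r)"
    using 0 by (intro exp_memoryless) auto
  also have "(\<integral>\<^sup>+a. g a \<partial>exp_measure r) = (\<integral>\<^sup>+z. h z \<partial>exp_seq r)"
    unfolding g_def by (subst nn_integral_exp_seq[symmetric]) auto
  also have "ennreal (exp (- r * t)) = (\<integral>\<^sup>+a. indicator {t<..} a \<partial>exp_measure r)"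
    using emeasure_exp_gt[OF 0] by simp
  also have "\<dots> = (\<integral>\<^sup>+a. \<integral>\<^sup>+z. of_bool (t < a) \<partial>exp_seq r \<partial>exp_measure r)"
    using S.emeasure_space_1 by (intro nn_integral_cong) (auto simp: indicator_def)
  also have "\<dots> = (\<integral>\<^sup>+z. of_bool (t < z 0) \<partial>exp_seq r)"
    by (subst nn_integral_exp_seq) auto
  finally show ?case unfolding arr_0 add_0 by simp
next
  case (Suc m)
  note [measurable] = measurable_compose[OF measurable_residual_on[of "Suc m" t] assms(1)]
  let ?D = "\<lambda>m t z. (\<forall>l<m. arr z l \<le> t) \<and> t < arr z m"
  have D: "?D (Suc m) t (case_nat a z) \<longleftrightarrow> a \<le> t \<and> ?D m (t - a) z" for a z
    by (auto simp: All_less_Suc2 arr_case_nat_0 arr_case_nat_Suc algebra_simps)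
  define F where "F z = of_bool (?D (Suc m) t z) *
    h (case_nat (arr z (Suc m) - t) (\<lambda>k. z (Suc (Suc m + k))))" for z
  have [measurable]: "F \<in> borel_measurable seq_borel"
    unfolding F_def by measurable
  have F: "F (case_nat a z) = of_bool (a \<le> t) * (of_bool (?D m (t - a) z) *
      h (case_nat (arr z m - (t - a)) (\<lambda>k. z (Suc (m + k)))))" for a z
  proof -
    have "arr (case_nat a z) (Suc m) - t = arr z m - (t - a)" by (simp add: arr_case_nat_Suc)
    moreover have "(\<lambda>k. case_nat a z (Suc (Suc m + k))) = (\<lambda>k. z (Suc (m + k)))" by simp
    ultimately show ?thesis unfolding F_def D by (simp only: of_bool_conj mult.assoc)
  qed
  have "(\<integral>\<^sup>+z. F z \<partial>exp_seq r) = (\<integral>\<^sup>+a. \<integral>\<^sup>+z. F (case_nat a z) \<partial>exp_seq r \<partial>exp_measure r)"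
    by (rule nn_integral_exp_seq) measurable
  also have "\<dots> = (\<integral>\<^sup>+a. of_bool (a \<le> t) * (\<integral>\<^sup>+z. of_bool (?D m (t - a) z) *
        h (case_nat (arr z m - (t - a)) (\<lambda>k. z (Suc (m + k)))) \<partial>exp_seq r) \<partial>exp_measure r)"
    unfolding F by (intro nn_integral_cong) simp
  \<comment> \<open>The induction hypothesis needs t - a \<ge> 0; for a > t both sides carry the
    factor zero.\<close>
  also have "\<dots> = (\<integral>\<^sup>+a. (of_bool (a \<le> t) * (\<integral>\<^sup>+z. of_bool (?D m (t - a) z) \<partial>exp_seq r)) *
      (\<integral>\<^sup>+z. h z \<partial>exp_seq r) \<partial>exp_measure r)"
    by (intro nn_integral_cong) (auto simp: Suc.IH mult.assoc)
  also have "\<dots> = (\<integral>\<^sup>+a. of_bool (a \<le> t) * (\<integral>\<^sup>+z. of_bool (?D m (t - a) z) \<partial>exp_seq r) \<partial>exp_measure r) *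
      (\<integral>\<^sup>+z. h z \<partial>exp_seq r)"
    by (intro nn_integral_multc) measurable
  also have "(\<integral>\<^sup>+a. of_bool (a \<le> t) * (\<integral>\<^sup>+z. of_bool (?D m (t - a) z) \<partial>exp_seq r) \<partial>exp_measure r) =
      (\<integral>\<^sup>+a. \<integral>\<^sup>+z. of_bool (?D (Suc m) t (case_nat a z)) \<partial>exp_seq r \<partial>exp_measure r)"
    unfolding D by (intro nn_integral_cong) auto
  also have "\<dots> = (\<integral>\<^sup>+z. of_bool (?D (Suc m) t z) \<partial>exp_seq r)"
    by (rule nn_integral_exp_seq[symmetric]) measurable
  finally show ?case unfolding F_def .
qed

text \<open>Sum over the number of arrivals up to t: each case contributes its probability times the
  integral of \<open>h\<close>, and the probabilities add up to one.\<close>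

lemma nn_integral_residual:
  assumes [measurable]: "h \<in> borel_measurable seq_borel" and t: "0 \<le> t"
  shows "(\<integral>\<^sup>+z. h (residual t z) \<partial>exp_seq r) = (\<integral>\<^sup>+z. h z \<partial>exp_seq r)"
proof -
  note [measurable] = measurable_compose[OF measurable_residual_on[of _ t] assms(1)]
  let ?D = "\<lambda>m z. (\<forall>l<m. arr z l \<le> t) \<and> t < arr z m"
  have D: "?D m z \<longleftrightarrow> m = arrivals_upto z t" if "regular z" for m z
    unfolding not_le[of "arr z m" t, symmetric] arr_le_iff[OF that]
    by (metis linorder_neqE_nat less_irrefl)
  have sum: "(\<Sum>m. of_bool (?D m z) * f m) = (f (arrivals_upto z t) :: ennreal)" if "regular z" for z f
    unfolding D[OF that] by (subst suminf_finite[of "{arrivals_upto z t}"]) auto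
  have "(\<integral>\<^sup>+z. h (residual t z) \<partial>exp_seq r) =
      (\<integral>\<^sup>+z. (\<Sum>m. of_bool (?D m z) * h (case_nat (arr z m - t) (\<lambda>k. z (Suc (m + k))))) \<partial>exp_seq r)"
  proof (rule nn_integral_cong_AE)
    show "AE z in exp_seq r. h (residual t z) =
        (\<Sum>m. of_bool (?D m z) * h (case_nat (arr z m - t) (\<lambda>k. z (Suc (m + k)))))"
      using AE_regular
    proof eventually_elim
      case (elim z)
      have "residual t z = case_nat (arr z (arrivals_upto z t) - t) (\<lambda>k. z (Suc (arrivals_upto z t + k)))"
        by (rule ext) (simp add: residual_def split: nat.split)
      then show ?case by (subst sum[OF elim]) simp
    qed
  qed
  also have "\<dots> = (\<Sum>m. (\<integral>\<^sup>+z. of_bool (?D m z) *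
      h (case_nat (arr z m - t) (\<lambda>k. z (Suc (m + k)))) \<partial>exp_seq r))"
    by (rule nn_integral_suminf) measurable
  also have "\<dots> = (\<Sum>m. (\<integral>\<^sup>+z. of_bool (?D m z) \<partial>exp_seq r) * (\<integral>\<^sup>+z. h z \<partial>exp_seq r))"
    by (intro suminf_cong nn_integral_residual_on t) measurable
  also have "\<dots> = (\<Sum>m. \<integral>\<^sup>+z. of_bool (?D m z) \<partial>exp_seq r) * (\<integral>\<^sup>+z. h z \<partial>exp_seq r)"
    by (rule ennreal_suminf_multc)
  also have "(\<Sum>m. \<integral>\<^sup>+z. of_bool (?D m z) \<partial>exp_seq r) = (\<integral>\<^sup>+z. (\<Sum>m. of_bool (?D m z)) \<partial>exp_seq r)"
    by (rule nn_integral_suminf[symmetric]) measurable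
  also have "\<dots> = (\<integral>\<^sup>+z. 1 \<partial>exp_seq r)"
  proof (rule nn_integral_cong_AE)
    show "AE z in exp_seq r. (\<Sum>m. of_bool (?D m z)) = (1::ennreal)"
      using AE_regular
    proof eventually_elim
      case (elim z)
      show ?case using sum[OF elim, of "\<lambda>_. 1"] by simp
    qed
  qed
  also have "\<dots> = 1" using S.emeasure_space_1 by simp
  finally show ?thesis by simp
qed

text \<open>The event on the first arrival is decided by time w, hence independent of the restart at
  w. An early arrival is followed by a fresh sequence, a late one is memoryless, and the
  unconstrained case is the restart law.\<close>

lemma nn_integral_first_residual:
  assumes [measurable]: "h \<in> borel_measurable seq_borel" "A \<in> sets borel" and w: "0 \<le> w"
    and A: "A \<subseteq> {..w} \<or> A = {w<..} \<or> A = UNIV"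
  shows "(\<integral>\<^sup>+z. indicator A (z 0) * h (residual w z) \<partial>exp_seq r) =
    emeasure (exp_measure r) A * (\<integral>\<^sup>+z. h z \<partial>exp_seq r)"
  using A
proof (elim disjE)
  assume A: "A \<subseteq> {..w}"
  have "(\<integral>\<^sup>+z. indicator A (z 0) * h (residual w z) \<partial>exp_seq r) =
      (\<integral>\<^sup>+a. \<integral>\<^sup>+z. indicator A a * h (residual w (case_nat a z)) \<partial>exp_seq r \<partial>exp_measure r)"
    by (subst nn_integral_exp_seq) auto
  also have "\<dots> = (\<integral>\<^sup>+a. indicator A a * (\<integral>\<^sup>+z. h z \<partial>exp_seq r) \<partial>exp_measure r)"
  proof (intro nn_integral_cong)
    fix a
    show "(\<integral>\<^sup>+z. indicator A a * h (residual w (case_nat a z)) \<partial>exp_seq r) =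
        indicator A a * (\<integral>\<^sup>+z. h z \<partial>exp_seq r)"
    proof (cases "a \<in> A")
      case True
      with A have a: "a \<le> w" by auto
      \<comment> \<open>After an arrival at a the tail is restarted at w - a; its law does not
        depend on a.\<close>
      have "(\<integral>\<^sup>+z. h (residual w (case_nat a z)) \<partial>exp_seq r) = (\<integral>\<^sup>+z. h (residual (w - a) z) \<partial>exp_seq r)"
        using AE_regular a by (intro nn_integral_cong_AE) (auto simp: residual_case_nat_le elim!: eventually_mono)
      also have "\<dots> = (\<integral>\<^sup>+z. h z \<partial>exp_seq r)" using a by (intro nn_integral_residual) auto
      finally show ?thesis using True by simp
    qed simp
  qed
  also have "\<dots> = emeasure (exp_measure r) A * (\<integral>\<^sup>+z. h z \<partial>exp_seq r)"
    by (subst nn_integral_multc) auto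
  finally show ?thesis .
next
  assume A: "A = {w<..}"
  define g where "g a = (\<integral>\<^sup>+z. h (case_nat a z) \<partial>exp_seq r)" for a
  have [measurable]: "g \<in> borel_measurable borel"
    unfolding g_def by measurable
  have "(\<integral>\<^sup>+z. indicator A (z 0) * h (residual w z) \<partial>exp_seq r) =
      (\<integral>\<^sup>+a. \<integral>\<^sup>+z. indicator A a * h (residual w (case_nat a z)) \<partial>exp_seq r \<partial>exp_measure r)"
    by (subst nn_integral_exp_seq) auto
  also have "\<dots> = (\<integral>\<^sup>+a. indicator A a * g (a - w) \<partial>exp_measure r)"
  proof (intro nn_integral_cong)
    fix a
    show "(\<integral>\<^sup>+z. indicator A a * h (residual w (case_nat a z)) \<partial>exp_seq r) = indicator A a * g (a - w)"
    proof (cases "a \<in> A")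
      case True
      with A have a: "w < a" by auto
      have "(\<integral>\<^sup>+z. h (residual w (case_nat a z)) \<partial>exp_seq r) = g (a - w)"
        unfolding g_def
        using AE_regular a by (intro nn_integral_cong_AE) (auto simp: residual_case_nat_gt elim!: eventually_mono)
      then show ?thesis using True by simp
    qed simp
  qed
  also have "\<dots> = ennreal (exp (- r * w)) * (\<integral>\<^sup>+a. g a \<partial>exp_measure r)"
    unfolding A using w by (intro exp_memoryless) auto
  also have "(\<integral>\<^sup>+a. g a \<partial>exp_measure r) = (\<integral>\<^sup>+z. h z \<partial>exp_seq r)"
    unfolding g_def by (subst nn_integral_exp_seq[symmetric]) auto
  finally show ?thesis using w by (simp add: A emeasure_exp_gt)
next
  assume "A = UNIV"
  then show ?thesis using w nn_integral_residual[OF assms(1) w] E.emeasure_space_1 by simp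
qed

lemma emeasure_first_residual:
  assumes [measurable]: "H \<in> sets seq_borel" "A \<in> sets borel" and w: "0 \<le> w"
    and A: "A \<subseteq> {..w} \<or> A = {w<..} \<or> A = UNIV"
  shows "emeasure (exp_seq r) {z. z 0 \<in> A \<and> residual w z \<in> H} =
    emeasure (exp_measure r) A * emeasure (exp_seq r) H"
proof -
  have "{z. z 0 \<in> A \<and> residual w z \<in> H} = {z \<in> space seq_borel. z 0 \<in> A \<and> residual w z \<in> H}"
    by (simp add: space_PiM)
  also have "\<dots> \<in> sets seq_borel" by measurable
  finally have [measurable]: "{z. z 0 \<in> A \<and> residual w z \<in> H} \<in> sets seq_borel" .
  have "emeasure (exp_seq r) {z. z 0 \<in> A \<and> residual w z \<in> H} =
      (\<integral>\<^sup>+z. indicator {z. z 0 \<in> A \<and> residual w z \<in> H} z \<partial>exp_seq r)"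
    by (rule nn_integral_indicator[symmetric]) simp
  also have "\<dots> = (\<integral>\<^sup>+z. indicator A (z 0) * indicator H (residual w z) \<partial>exp_seq r)"
    by (intro nn_integral_cong) (auto simp: indicator_def)
  also have "\<dots> = emeasure (exp_measure r) A * emeasure (exp_seq r) H"
    using w A by (subst nn_integral_first_residual) auto
  finally show ?thesis .
qed

section \<open>Mean numbers of arrivals\<close>

text \<open>Stationary increments: counting over an interval is counting after a restart at its left
  end.\<close>

lemma nn_integral_arrivals_increment:
  assumes "0 \<le> a" "a \<le> b"
  shows "(\<integral>\<^sup>+z. ennreal (real (arrivals_upto z b - arrivals_upto z a)) \<partial>exp_seq r) =
    (\<integral>\<^sup>+z. ennreal (real (arrivals_upto z (b - a))) \<partial>exp_seq r)"
proof -
  have "(\<integral>\<^sup>+z. ennreal (real (arrivals_upto z b - arrivals_upto z a)) \<partial>exp_seq r) =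
      (\<integral>\<^sup>+z. ennreal (real (arrivals_upto (residual a z) (b - a))) \<partial>exp_seq r)"
    using AE_regular assms
    by (intro nn_integral_cong_AE) (auto simp: arrivals_upto_residual elim!: eventually_mono)
  also have "\<dots> = (\<integral>\<^sup>+z. ennreal (real (arrivals_upto z (b - a))) \<partial>exp_seq r)"
    using assms by (intro nn_integral_residual) measurable
  finally show ?thesis .
qed

lemma nn_integral_arrivals_upto_mono:
  "s \<le> t \<Longrightarrow> (\<integral>\<^sup>+z. ennreal (real (arrivals_upto z s)) \<partial>exp_seq r) \<le>
    (\<integral>\<^sup>+z. ennreal (real (arrivals_upto z t)) \<partial>exp_seq r)"
  using AE_regular
  by (intro nn_integral_mono_AE) (auto intro!: ennreal_leI arrivals_upto_mono elim!: eventually_mono)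

lemma nn_integral_arrivals_upto_finite:
  "(\<integral>\<^sup>+z. ennreal (real (arrivals_upto z t)) \<partial>exp_seq r) < \<infinity>"
proof -
  have "(\<integral>\<^sup>+z. ennreal (real (arrivals_upto z t)) \<partial>exp_seq r) =
      (\<integral>\<^sup>+z. (\<Sum>m. indicator {..t} (arr z m)) \<partial>exp_seq r)"
  proof (rule nn_integral_cong_AE)
    show "AE z in exp_seq r. ennreal (real (arrivals_upto z t)) = (\<Sum>m. indicator {..t} (arr z m))"
      using AE_regular
    proof eventually_elim
      case (elim z)
      have "(\<Sum>m. indicator {..t} (arr z m) :: ennreal) = (\<Sum>m<arrivals_upto z t. indicator {..t} (arr z m))"
        by (rule suminf_finite) (auto simp: arr_le_iff[OF elim])
      also have "\<dots> = (\<Sum>m<arrivals_upto z t. 1)"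
        by (intro sum.cong) (auto simp: arr_le_iff[OF elim])
      finally show ?case by (simp add: ennreal_of_nat_eq_real_of_nat)
    qed
  qed
  then show ?thesis using nn_integral_sum_arrivals_finite by simp
qed

end

section \<open>Configurations of Poisson processes\<close>

text \<open>Versions received along at most d gossip hops. Unlike in \<open>has_ver\<close>, the intermediate times are
  rational, which makes measurability evident.\<close>

primrec ver_depth ::
  "nat \<Rightarrow> real \<Rightarrow> nat \<Rightarrow> nat \<Rightarrow> real \<Rightarrow> nat \<Rightarrow> (proc \<Rightarrow> nat \<Rightarrow> real) \<Rightarrow> bool" where
  "ver_depth n \<delta> 0 i t v x \<longleftrightarrow> v = 0 \<or> (i \<in> {1..n} \<and>
     (\<exists>m. arr (x (Src i)) m \<le> t \<and> v = src_ver x (arr (x (Src i)) m)))"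
| "ver_depth n \<delta> (Suc d) i t v x \<longleftrightarrow> ver_depth n \<delta> d i t v x \<or> (i \<in> {1..n} \<and>
     (\<exists>j\<in>{1..n} - {i}. \<exists>q::rat. \<exists>m. ver_depth n \<delta> d j (of_rat q) v x \<and>
        of_rat q < arr (x (Gsp j i)) m \<and> arr (x (Gsp j i)) m \<le> t \<and>
        delivered n x \<delta> j (arr (x (Gsp j i)) m)))"

lemma ver_depth_mono: "ver_depth n \<delta> d i s v x \<Longrightarrow> s \<le> t \<Longrightarrow> ver_depth n \<delta> d i t v x"
proof (induction d)
  case 0
  then consider "v = 0" | m where "i \<in> {1..n}" "arr (x (Src i)) m \<le> s" "v = src_ver x (arr (x (Src i)) m)"
    by auto
  then show ?case using 0(2) by cases (auto intro: order_trans)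
next
  case (Suc d)
  consider "ver_depth n \<delta> d i s v x"
    | j q m where "i \<in> {1..n}" "j \<in> {1..n} - {i}" "ver_depth n \<delta> d j (of_rat q) v x"
        "of_rat q < arr (x (Gsp j i)) m" "arr (x (Gsp j i)) m \<le> s"
        "delivered n x \<delta> j (arr (x (Gsp j i)) m)"
    using Suc.prems(1) unfolding ver_depth.simps by blast
  then show ?case
  proof cases
    case 1
    then show ?thesis using Suc by simp
  next
    case 2
    moreover from 2 have "arr (x (Gsp j i)) m \<le> t" using Suc.prems(2) by simp
    ultimately show ?thesis unfolding ver_depth.simps by blast
  qed
qed

lemma has_ver_iff_ver_depth: "has_ver n x \<delta> i t v \<longleftrightarrow> (\<exists>d. ver_depth n \<delta> d i t v x)"
proof
  assume "has_ver n x \<delta> i t v"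
  then show "\<exists>d. ver_depth n \<delta> d i t v x"
  proof induction
    case (init i t)
    have "ver_depth n \<delta> 0 i t 0 x" by simp
    then show ?case ..
  next
    case (from_src i m t)
    then have "ver_depth n \<delta> 0 i t (src_ver x (arr (x (Src i)) m)) x" by auto
    then show ?case ..
  next
    case (from_gossip i j s v m t)
    then obtain d where d: "ver_depth n \<delta> d j s v x" by auto
    \<comment> \<open>\<open>from_gossip\<close> has a strict inequality, which leaves room for a
      rational time before the tick; a version once held stays available until then.\<close>
    obtain q :: rat where q: "s < of_rat q" "of_rat q < arr (x (Gsp j i)) m"
      using of_rat_dense from_gossip by blast
    have "ver_depth n \<delta> d j (of_rat q) v x" using d q by (auto intro: ver_depth_mono)
    then have "ver_depth n \<delta> (Suc d) i t v x" using from_gossip q by auto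
    then show ?case ..
  qed
next
  have "ver_depth n \<delta> d i t v x \<Longrightarrow> has_ver n x \<delta> i t v" for d
  proof (induction d arbitrary: i t)
    case 0
    then show ?case by (auto intro: has_ver.intros)
  next
    case (Suc d)
    consider "ver_depth n \<delta> d i t v x"
      | j q m where "i \<in> {1..n}" "j \<in> {1..n}" "j \<noteq> i" "ver_depth n \<delta> d j (of_rat q) v x"
          "of_rat q < arr (x (Gsp j i)) m" "arr (x (Gsp j i)) m \<le> t"
          "delivered n x \<delta> j (arr (x (Gsp j i)) m)"
      using Suc.prems unfolding ver_depth.simps by blast
    then show ?case
    proof cases
      case 1
      then show ?thesis by (rule Suc.IH)
    next
      case 2
      then show ?thesis using Suc.IH by (intro has_ver.from_gossip[of i n j x \<delta> "of_rat q" v m t])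
    qed
  qed
  then show "\<exists>d. ver_depth n \<delta> d i t v x \<Longrightarrow> has_ver n x \<delta> i t v" by auto
qed

section \<open>Measurability on the configuration space\<close>

abbreviation config_borel :: "nat \<Rightarrow> (proc \<Rightarrow> nat \<Rightarrow> real) measure" where
  "config_borel n \<equiv> PiM (procs n) (\<lambda>_. seq_borel)"

lemma pred_le_borel:
  fixes f g :: "'a \<Rightarrow> real"
  shows "f \<in> borel_measurable M \<Longrightarrow> g \<in> borel_measurable M \<Longrightarrow> Measurable.pred M (\<lambda>x. f x \<le> g x)"
  unfolding pred_def by (rule borel_measurable_le)

lemma measurable_config_nth:
  assumes "k \<in> procs n"
  shows "(\<lambda>x. x k m) \<in> borel_measurable (config_borel n)"
proof -
  have "(\<lambda>x. x k) \<in> measurable (config_borel n) seq_borel"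
    using assms by (rule measurable_component_singleton)
  moreover have "(\<lambda>z. z m) \<in> measurable seq_borel (borel :: real measure)"
    by (rule measurable_component_singleton) simp
  ultimately show ?thesis by (rule measurable_compose)
qed

lemma measurable_config_arr [measurable]:
  assumes "k \<in> procs n"
  shows "(\<lambda>x. arr (x k) m) \<in> borel_measurable (config_borel n)"
  using assms by measurable

lemma measurable_src_ver_at [measurable (raw)]:
  assumes [measurable]: "f \<in> borel_measurable (config_borel n)"
  shows "(\<lambda>x. src_ver x (f x)) \<in> measurable (config_borel n) (count_space UNIV)"
  unfolding src_ver_def
  by (rule measurable_card)
    (auto simp flip: pred_def intro!: pred_le_borel measurable_config_arr assms)

lemma measurable_gossiping_at [measurable (raw)]:
  assumes [measurable]: "f \<in> borel_measurable (config_borel n)" and j: "j \<in> {1..n}"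
  shows "Measurable.pred (config_borel n) (\<lambda>x. gossiping x \<delta> j (f x))"
proof -
  have [measurable]: "Src j \<in> procs n" using j by simp
  show ?thesis
    unfolding gossiping_def
    by (intro pred_intros_countable pred_intros_logic pred_le_borel borel_measurable_pred_less
        borel_measurable_add measurable_config_arr assms(1) borel_measurable_const) fact+
qed

lemma measurable_delivered_at [measurable (raw)]:
  assumes f: "f \<in> borel_measurable (config_borel n)" and j: "j \<in> {1..n}"
  shows "Measurable.pred (config_borel n) (\<lambda>x. delivered n x \<delta> j (f x))"
  unfolding delivered_def
  by (intro pred_intros_logic pred_intros_finite measurable_gossiping_at f j) auto

lemma measurable_ver_depth [measurable]:
  "Measurable.pred (config_borel n) (ver_depth n \<delta> d i t v)"
proof (induction d arbitrary: i t)
  case 0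
  show ?case
  proof (cases "i \<in> {1..n}")
    case True
    then have [measurable]: "Src i \<in> procs n" by simp
    show ?thesis using True by simp
  qed simp
next
  case (Suc d)
  note [measurable] = Suc.IH
  have [measurable]: "Measurable.pred (config_borel n) (\<lambda>x. \<exists>q::rat. \<exists>m. ver_depth n \<delta> d j (of_rat q) v x \<and>
        of_rat q < arr (x (Gsp j i)) m \<and> arr (x (Gsp j i)) m \<le> t \<and>
        delivered n x \<delta> j (arr (x (Gsp j i)) m))" if "i \<in> {1..n}" "j \<in> {1..n} - {i}" for j
  proof -
    have [measurable]: "Gsp j i \<in> procs n" "j \<in> {1..n}" using that by auto
    show ?thesis by measurable
  qed
  show ?case
  proof (cases "i \<in> {1..n}")
    case True
    then show ?thesis
      unfolding ver_depth.simps
      by (intro pred_intros_logic pred_intros_finite) (auto intro: Suc.IH simp del: ex_simps)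
  next
    case False
    then show ?thesis using Suc.IH by simp
  qed
qed

text \<open>Measurability holds on the whole space, including points where no greatest element
  exists and \<open>GREATEST\<close> takes a default value.\<close>

lemma measurable_Greatest_nat:
  fixes P :: "nat \<Rightarrow> 'a \<Rightarrow> bool"
  assumes [measurable]: "\<And>v. Measurable.pred M (P v)"
  shows "(\<lambda>x. GREATEST v. P v x) \<in> measurable M (count_space UNIV)"
proof (rule measurable_count_space_eq2_countable[THEN iffD2], safe)
  fix a :: nat
  let ?G = "\<lambda>v x. P v x \<and> (\<forall>u. P u x \<longrightarrow> u \<le> v)"
  \<comment> \<open>The default of \<open>GREATEST\<close>: one constant for all such points, since
    the description is then of the empty predicate.\<close>
  define c :: nat where "c = (THE v. False)"
  have "(GREATEST v. P v x) = a \<longleftrightarrow> ?G a x \<or> (\<not> (\<exists>v. ?G v x) \<and> c = a)" for x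
  proof (cases "\<exists>v. ?G v x")
    case True
    then obtain v where v: "?G v x" by auto
    then have "(GREATEST v. P v x) = v" by (intro Greatest_equality) auto
    with v show ?thesis by (metis le_antisym)
  next
    case False
    then have "\<forall>v. ?G v x = False" by (simp only: not_ex simp_thms)
    then have "(\<lambda>v. ?G v x) = (\<lambda>_. False)" unfolding fun_eq_iff .
    then have "(GREATEST v. P v x) = c" by (simp only: Greatest_def c_def)
    with False show ?thesis by auto
  qed
  then have "(\<lambda>x. GREATEST v. P v x) -` {a} \<inter> space M =
      {x \<in> space M. ?G a x \<or> (\<not> (\<exists>v. ?G v x) \<and> c = a)}" by auto
  also have "\<dots> \<in> sets M" by measurable
  finally show "(\<lambda>x. GREATEST v. P v x) -` {a} \<inter> space M \<in> sets M" .
qed auto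

lemma measurable_age [measurable]: "(\<lambda>x. age n x \<delta> i t) \<in> borel_measurable (config_borel n)"
proof -
  have [measurable]: "(\<lambda>x. node_ver n x \<delta> i t) \<in> measurable (config_borel n) (count_space UNIV)"
    unfolding node_ver_def has_ver_iff_ver_depth by (rule measurable_Greatest_nat) measurable
  have [measurable]: "(\<lambda>x. src_ver x t) \<in> measurable (config_borel n) (count_space UNIV)"
    by (rule measurable_src_ver_at) simp
  show ?thesis unfolding age_def by measurable
qed

lemma measurable_trunc_age [measurable]:
  "trunc_age n \<delta> i a t \<in> borel_measurable (config_borel n)"
proof -
  have [measurable]: "(\<lambda>x. src_ver x s) \<in> measurable (config_borel n) (count_space UNIV)" for s
    by (rule measurable_src_ver_at) simp
  show ?thesis unfolding trunc_age_def[abs_def] by measurable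
qed

lemma measurable_residual_config [measurable]:
  "residual_config n s \<in> measurable (config_borel n) (config_borel n)"
  unfolding residual_config_def[abs_def] by (rule measurable_restrict) measurable

lemma first_contact_borel [measurable]: "first_contact n \<delta> i j k \<in> sets borel"
  by (cases k) (auto simp: first_contact_def)

lemma measurable_success [measurable]: "Measurable.pred (config_borel n) (success n \<delta> i)"
  unfolding success_def[abs_def]
  by (intro pred_intros_finite) (auto intro!: pred_sets2[OF first_contact_borel] measurable_config_nth)

lemma measurable_fail [measurable]: "Measurable.pred (config_borel n) (fail n \<delta> i l)"
  by (induction l) (simp_all add: measurable_compose[OF measurable_residual_config])

section \<open>Joint law of first arrivals and the restarted configuration\<close>

text \<open>The conditions on \<open>A k\<close> say that \<open>{z. z 0 \<in> A k}\<close> depends only on the arrivals up to time \<open>w\<close>.\<close>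

lemma emeasure_PiM_first_residual:
  fixes n :: nat and \<rho> :: "proc \<Rightarrow> real"
  defines "P \<equiv> PiM (procs n) (\<lambda>k. exp_seq (\<rho> k))"
  assumes \<rho>: "\<And>k. 0 < \<rho> k" and w: "0 \<le> w" and H: "H \<in> sets (config_borel n)"
    and A: "\<And>k. A k \<in> sets borel" "\<And>k. k \<in> procs n \<Longrightarrow> A k \<subseteq> {..w} \<or> A k = {w<..} \<or> A k = UNIV"
  shows "emeasure P {x \<in> space P. (\<forall>k\<in>procs n. x k 0 \<in> A k) \<and> residual_config n w x \<in> H} =
    (\<Prod>k\<in>procs n. emeasure (exp_measure (\<rho> k)) (A k)) * emeasure P H"
proof -
  interpret product_prob_space "\<lambda>k. exp_seq (\<rho> k)" "procs n"
    by (intro product_prob_spaceI prob_space_exp_seq \<rho>)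
  have sets_P [measurable_cong]: "sets P = sets (config_borel n)"
    unfolding P_def by (intro sets_PiM_cong) auto
  have space_P: "space P = extensional (procs n)"
    unfolding P_def space_PiM by (auto simp: PiE_def)
  define B where "B = {x \<in> space P. \<forall>k\<in>procs n. x k 0 \<in> A k}"
  have B [measurable]: "B \<in> sets P"
  proof -
    have "Measurable.pred (config_borel n) (\<lambda>x. \<forall>k\<in>procs n. x k 0 \<in> A k)"
      by (intro pred_intros_finite pred_sets2[OF A(1)] measurable_config_nth) auto
    moreover have "space P = space (config_borel n)" by (rule sets_eq_imp_space_eq[OF sets_P])
    ultimately show ?thesis unfolding B_def sets_P by (simp add: pred_def)
  qed
  \<comment> \<open>The claim is an identity of measures in \<open>H\<close>: the law of the
    restarted configuration on the event \<open>B\<close> against \<open>c\<close> times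
    \<open>P\<close>. It is checked on boxes.\<close>
  define \<mu>1 where "\<mu>1 = distr (density P (indicator B)) (config_borel n) (residual_config n w)"
  define c where "c = (\<Prod>k\<in>procs n. emeasure (exp_measure (\<rho> k)) (A k))"
  have \<mu>1: "emeasure \<mu>1 C = emeasure P {x \<in> space P. (\<forall>k\<in>procs n. x k 0 \<in> A k) \<and> residual_config n w x \<in> C}"
    if [measurable]: "C \<in> sets (config_borel n)" for C
  proof -
    have "emeasure \<mu>1 C = emeasure (density P (indicator B)) (residual_config n w -` C \<inter> space P)"
      unfolding \<mu>1_def by (subst emeasure_distr) auto
    also have "\<dots> = emeasure P (B \<inter> (residual_config n w -` C \<inter> space P))"
    proof -
      have "residual_config n w -` C \<inter> space P \<in> sets P" by measurable
      then show ?thesis by (subst emeasure_density) (auto simp: nn_integral_restrict_space[symmetric] indicator_inter_arith[symmetric])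
    qed
    also have "B \<inter> (residual_config n w -` C \<inter> space P) =
        {x \<in> space P. (\<forall>k\<in>procs n. x k 0 \<in> A k) \<and> residual_config n w x \<in> C}"
      unfolding B_def by auto
    finally show ?thesis .
  qed
  have box: "emeasure \<mu>1 (Pi\<^sub>E (procs n) C) = emeasure (scale_measure c P) (Pi\<^sub>E (procs n) C)"
    if C: "\<And>k. k \<in> procs n \<Longrightarrow> C k \<in> sets seq_borel" for C
  proof -
    have "emeasure \<mu>1 (Pi\<^sub>E (procs n) C) =
        emeasure P {x \<in> space P. (\<forall>k\<in>procs n. x k 0 \<in> A k) \<and> residual_config n w x \<in> Pi\<^sub>E (procs n) C}"
      by (intro \<mu>1 sets_PiM_I_finite C) auto
    \<comment> \<open>On a box both conditions split over the coordinates, and the product measure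
      reduces them to one process each.\<close>
    also have "{x \<in> space P. (\<forall>k\<in>procs n. x k 0 \<in> A k) \<and> residual_config n w x \<in> Pi\<^sub>E (procs n) C} =
        Pi\<^sub>E (procs n) (\<lambda>k. {z. z 0 \<in> A k \<and> residual w z \<in> C k})"
      unfolding space_P by (auto simp: residual_config_def PiE_iff extensional_def)
    also have "emeasure P \<dots> = (\<Prod>k\<in>procs n. emeasure (exp_seq (\<rho> k)) {z. z 0 \<in> A k \<and> residual w z \<in> C k})"
      unfolding P_def
    proof (intro emeasure_PiM)
      fix k assume k: "k \<in> procs n"
      note [measurable] = A(1)[of k] C[OF k]
      have "{z \<in> space seq_borel. z 0 \<in> A k \<and> residual w z \<in> C k} \<in> sets seq_borel" by measurable
      then show "{z. z 0 \<in> A k \<and> residual w z \<in> C k} \<in> sets (exp_seq (\<rho> k))" by (simp add: space_PiM)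
    qed auto
    also have "\<dots> = (\<Prod>k\<in>procs n. emeasure (exp_measure (\<rho> k)) (A k) * emeasure (exp_seq (\<rho> k)) (C k))"
      by (intro prod.cong refl emeasure_first_residual \<rho> A C w)
    also have "\<dots> = c * (\<Prod>k\<in>procs n. emeasure (exp_seq (\<rho> k)) (C k))"
      unfolding c_def by (rule prod.distrib)
    also have "(\<Prod>k\<in>procs n. emeasure (exp_seq (\<rho> k)) (C k)) = emeasure P (Pi\<^sub>E (procs n) C)"
      unfolding P_def using C by (intro emeasure_PiM[symmetric]) auto
    finally show ?thesis by simp
  qed
  have "\<mu>1 = scale_measure c P"
  proof (rule measure_eqI_PiM_finite[where I = "procs n" and M = "\<lambda>_. seq_borel"
        and A = "\<lambda>_::nat. Pi\<^sub>E (procs n) (\<lambda>_. space seq_borel)"])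
    show "range (\<lambda>_::nat. Pi\<^sub>E (procs n) (\<lambda>_. space seq_borel)) \<subseteq> prod_algebra (procs n) (\<lambda>_. seq_borel)"
      by (auto intro!: prod_algebraI_finite)
    fix i :: nat
    have "emeasure \<mu>1 (Pi\<^sub>E (procs n) (\<lambda>_. space seq_borel)) \<le> emeasure P (space P)"
      by (subst \<mu>1) (auto intro!: emeasure_mono sets_PiM_I_finite)
    then show "emeasure \<mu>1 (Pi\<^sub>E (procs n) (\<lambda>_. space seq_borel)) \<noteq> \<infinity>"
      unfolding P_def using emeasure_space_1 by (auto simp: top_unique)
  next
    show "emeasure \<mu>1 (Pi\<^sub>E (procs n) C) = emeasure (scale_measure c P) (Pi\<^sub>E (procs n) C)"
      if "\<And>k. k \<in> procs n \<Longrightarrow> C k \<in> sets seq_borel" for C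
      using that by (rule box)
  qed (simp_all add: sets_P \<mu>1_def space_PiM)
  then show ?thesis
    using \<mu>1[OF H] by (simp add: c_def)
qed

section \<open>Success probability of a window\<close>

text \<open>Independence of all gaps is grouped twice: the gaps of one process form an i.i.d.
  sequence, and the sequences of different processes are independent.\<close>

lemma (in prob_space) distr_gossip_model:
  assumes model: "gossip_model M n lam_e lam B X"
  shows "distr M (config_borel n) (\<lambda>\<omega>. \<lambda>k\<in>procs n. \<lambda>m. X k m \<omega>) =
    PiM (procs n) (\<lambda>k. exp_seq (rate n lam_e lam B k))"
proof -
  have ind: "indep_vars (\<lambda>_. borel) (\<lambda>(k, m). X k m) (procs n \<times> UNIV)"
    and dist: "\<And>k m. k \<in> procs n \<Longrightarrow>
      distributed M lborel (X k m) (exponential_density (rate n lam_e lam B k))"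
    using model by (auto simp: gossip_model_def)
  have [measurable]: "X k m \<in> borel_measurable M" if "k \<in> procs n" for k m
    using distributed_measurable[OF dist[OF that, of m]] by simp
  have seq_meas: "(\<lambda>\<omega> m. X k m \<omega>) \<in> measurable M seq_borel" if "k \<in> procs n" for k
    using that by (intro measurable_PiM_single') (auto simp: space_PiM)
  have seq: "distr M seq_borel (\<lambda>\<omega> m. X k m \<omega>) = exp_seq (rate n lam_e lam B k)" if k: "k \<in> procs n" for k
  proof -
    have "indep_vars (\<lambda>m. PiM {(k, m)} (\<lambda>_. borel))
        (\<lambda>m \<omega>. restrict (\<lambda>p. (case p of (k, m) \<Rightarrow> X k m) \<omega>) {(k, m)}) UNIV"
      using k by (intro indep_vars_restrict[OF ind]) (auto simp: disjoint_family_on_def)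
    then have "indep_vars (\<lambda>_. borel)
        (\<lambda>m \<omega>. (\<lambda>f. f (k, m)) (restrict (\<lambda>p. (case p of (k, m) \<Rightarrow> X k m) \<omega>) {(k, m)})) UNIV"
      by (rule indep_vars_compose2) (rule measurable_component_singleton, simp)
    then have "indep_vars (\<lambda>_. borel) (\<lambda>m. X k m) UNIV" by simp
    then have "distr M seq_borel (\<lambda>\<omega>. \<lambda>m\<in>UNIV. X k m \<omega>) = PiM UNIV (\<lambda>m. distr M borel (X k m))"
      using k by (subst (asm) indep_vars_iff_distr_eq_PiM') auto
    moreover have "distr M borel (X k m) = exp_measure (rate n lam_e lam B k)" for m
    proof -
      have "distr M borel (X k m) = distr M lborel (X k m)" by (rule distr_cong) auto
      then show ?thesis
        unfolding exp_measure_def using distributed_distr_eq_density[OF dist[OF k, of m]] by simp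
    qed
    ultimately show ?thesis by (simp add: exp_seq_def restrict_UNIV)
  qed
  have "indep_vars (\<lambda>k. PiM ({k} \<times> UNIV) (\<lambda>_. borel))
      (\<lambda>k \<omega>. restrict (\<lambda>p. (case p of (k, m) \<Rightarrow> X k m) \<omega>) ({k} \<times> UNIV)) (procs n)"
    by (intro indep_vars_restrict[OF ind]) (auto simp: disjoint_family_on_def)
  then have "indep_vars (\<lambda>_. seq_borel)
      (\<lambda>k \<omega>. (\<lambda>f m. f (k, m)) (restrict (\<lambda>p. (case p of (k, m) \<Rightarrow> X k m) \<omega>) ({k} \<times> UNIV))) (procs n)"
  proof (rule indep_vars_compose2)
    fix k
    show "(\<lambda>f m. f (k, m)) \<in> measurable (PiM ({k} \<times> UNIV) (\<lambda>_. borel)) seq_borel"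
      by (intro measurable_PiM_single' measurable_component_singleton) (auto simp: space_PiM)
  qed
  then have "indep_vars (\<lambda>_. seq_borel) (\<lambda>k \<omega> m. X k m \<omega>) (procs n)" by simp
  then have "distr M (config_borel n) (\<lambda>\<omega>. \<lambda>k\<in>procs n. \<lambda>m. X k m \<omega>) =
      PiM (procs n) (\<lambda>k. distr M seq_borel (\<lambda>\<omega> m. X k m \<omega>))"
    using seq_meas by (subst (asm) indep_vars_iff_distr_eq_PiM') (auto intro: procs_simps(1))
  also have "\<dots> = PiM (procs n) (\<lambda>k. exp_seq (rate n lam_e lam B k))"
    by (intro PiM_cong refl seq)
  finally show ?thesis .
qed

text \<open>From \<open>1 + u \<le> exp u\<close> with u = r (b - a). The bound is linear in r, so a
  source rate of order 1/n yields a probability of order 1/n, made up for by the choices of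
  j.\<close>

lemma measure_exp_interval_ge:
  assumes "0 < r" "0 \<le> a" "a \<le> b"
  shows "r * (b - a) * exp (- r * b) \<le> measure (exp_measure r) {a<..b}"
proof -
  have "exp (- r * b) * (1 + r * (b - a)) \<le> exp (- r * b) * exp (r * (b - a))"
    by (intro mult_left_mono exp_ge_add_one_self) auto
  also have "\<dots> = exp (- r * a)" by (simp add: algebra_simps flip: exp_add)
  finally show ?thesis using assms by (simp add: measure_exp_interval algebra_simps)
qed

section \<open>The network with capacity \<open>n * lam\<close>\<close>

locale gossip_net =
  fixes n :: nat and lam_e lam \<delta> :: real
  assumes n: "2 \<le> n" and lam_e: "0 < lam_e" and lam: "0 < lam" and \<delta>: "0 < \<delta>"
begin

abbreviation \<rho> :: "proc \<Rightarrow> real" where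
  "\<rho> \<equiv> rate n lam_e lam (real n * lam)"

definition P :: "(proc \<Rightarrow> nat \<Rightarrow> real) measure" where
  "P = PiM (procs n) (\<lambda>k. exp_seq (\<rho> k))"

text \<open>The product of the bounds \<open>r (b - a) exp (- r b)\<close> for the two intervals in \<open>first_contact\<close> and of the
  void probabilities of the other source processes, summed over the \<open>n - 1 \<ge> n / 2\<close> choices of j.\<close>

definition p0 :: real where
  "p0 = (lam * \<delta>)\<^sup>2 / 16 * exp (- (11 / 2) * (lam * \<delta>))"

lemma rate_pos: "0 < \<rho> k"
  using n lam lam_e by (cases k) (auto simp: rate_def)

lemma rate_simps:
  "\<rho> Gen = lam_e" "\<rho> (Src j) = lam / real n" "\<rho> (Gsp j i) = real n * lam / (real n - 1)"
  by (simp_all add: rate_def)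

lemma prob_space_P: "prob_space P"
proof -
  interpret product_prob_space "\<lambda>k. exp_seq (\<rho> k)" "procs n"
    by (intro product_prob_spaceI prob_space_exp_seq rate_pos)
  show ?thesis unfolding P_def by (rule prob_space_axioms)
qed

sublocale P: prob_space P
  by (rule prob_space_P)

lemma sets_P [measurable_cong]: "sets P = sets (config_borel n)"
  unfolding P_def by (intro sets_PiM_cong) auto

lemma space_P: "space P = extensional (procs n)"
  unfolding P_def space_PiM by (auto simp: PiE_def)

lemma AE_regular_config: "AE x in P. regular_config n x"
  unfolding regular_config_def P_def
  by (intro AE_finite_allI finite_procs AE_PiM_component[where P = regular] prob_space_exp_seq rate_pos
      AE_regular)

lemma emeasure_residual_config:
  assumes "0 \<le> s" "H \<in> sets (config_borel n)"
  shows "emeasure P {x \<in> space P. residual_config n s x \<in> H} = emeasure P H"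
proof -
  have "emeasure (exp_measure (\<rho> k)) UNIV = 1" for k
    using prob_space.emeasure_space_1[OF prob_space_exp_measure[OF rate_pos[of k]]] by simp
  then show ?thesis
    using emeasure_PiM_first_residual[of \<rho> s H n "\<lambda>_. UNIV", OF rate_pos assms]
    by (simp add: P_def)
qed

lemma nn_integral_residual_config:
  assumes "0 \<le> s" and [measurable]: "f \<in> borel_measurable (config_borel n)"
  shows "(\<integral>\<^sup>+x. f (residual_config n s x) \<partial>P) = (\<integral>\<^sup>+x. f x \<partial>P)"
proof -
  have "distr P (config_borel n) (residual_config n s) = P"
  proof (rule measure_eqI)
    fix H assume "H \<in> sets (distr P (config_borel n) (residual_config n s))"
    then have [measurable]: "H \<in> sets (config_borel n)" by simp
    have "residual_config n s -` H \<inter> space P = {x \<in> space P. residual_config n s x \<in> H}" by auto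
    then show "emeasure (distr P (config_borel n) (residual_config n s)) H = emeasure P H"
      by (subst emeasure_distr) (auto simp: emeasure_residual_config[OF assms(1)])
  qed (simp add: sets_P)
  then have "(\<integral>\<^sup>+x. f x \<partial>P) = (\<integral>\<^sup>+x. f x \<partial>distr P (config_borel n) (residual_config n s))" by simp
  also have "\<dots> = (\<integral>\<^sup>+x. f (residual_config n s x) \<partial>P)"
    by (rule nn_integral_distr) measurable
  finally show ?thesis by simp
qed

section \<open>Uniform lower bound and geometric decay of failure\<close>

lemma p0_pos: "0 < p0"
  unfolding p0_def using lam \<delta> by (intro mult_pos_pos) auto

text \<open>Follows from y \<le> exp y, as the decay rate 11/2 in \<open>p0\<close> exceeds 2; it
  keeps 1 - p0 nonnegative.\<close>

lemma p0_le_1: "p0 \<le> 1"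
proof -
  let ?y = "lam * \<delta>"
  have "?y \<le> exp ?y" using exp_ge_add_one_self[of ?y] by linarith
  then have "?y\<^sup>2 \<le> (exp ?y)\<^sup>2" using lam \<delta> by (intro power_mono) auto
  also have "\<dots> = exp (2 * ?y)" by (rule exp_double[symmetric])
  finally have "?y\<^sup>2 * exp (- (11 / 2) * ?y) \<le> exp (2 * ?y) * exp (- (11 / 2) * ?y)"
    by (intro mult_right_mono) auto
  also have "\<dots> = exp (- (7 / 2) * ?y)" by (simp flip: exp_add)
  also have "\<dots> \<le> 1" using lam \<delta> by simp
  finally show ?thesis unfolding p0_def by simp
qed

text \<open>Only the source contacts and \<open>Gsp j i\<close> are constrained. Contacting j has
  probability of order 1/n, while the tick and the silence of the other n - 1 contacts have
  probabilities bounded below uniformly in n.\<close>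

lemma prob_first_contact_ge:
  assumes i: "i \<in> {1..n}" and j: "j \<in> {1..n} - {i}"
  shows "2 * p0 / real n \<le> (\<Prod>k\<in>procs n. measure (exp_measure (\<rho> k)) (first_contact n \<delta> i j k))"
proof -
  define f where "f k = measure (exp_measure (\<rho> k)) (first_contact n \<delta> i j k)" for k
  define y where "y = lam * \<delta>"
  have n_pos: "0 < real n" and n1: "0 < real n - 1" using n by auto
  have y: "0 < y" using lam \<delta> by (simp add: y_def)
  have f_UNIV: "f k = 1" if "first_contact n \<delta> i j k = UNIV" for k
    unfolding f_def that using prob_space.prob_space[OF prob_space_exp_measure[OF rate_pos[of k]]] by simp
  have "(\<Prod>k\<in>procs n. f k) = (\<Prod>k\<in>insert (Gsp j i) (Src ` {1..n}). f k)"
    using i j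
    by (intro prod.mono_neutral_right ballI f_UNIV finite_procs)
      (auto simp: procs_def first_contact_def split: if_splits)
  also have "\<dots> = f (Gsp j i) * (\<Prod>j'\<in>{1..n}. f (Src j'))"
    by (subst prod.insert) (auto simp: prod.reindex inj_on_def)
  also have "(\<Prod>j'\<in>{1..n}. f (Src j')) = f (Src j) * (\<Prod>j'\<in>{1..n} - {j}. f (Src j'))"
    using j by (intro prod.remove) auto
  also have "(\<Prod>j'\<in>{1..n} - {j}. f (Src j')) = (\<Prod>j'\<in>{1..n} - {j}. exp (- (lam / real n) * (2 * \<delta>)))"
  proof (intro prod.cong refl)
    fix j' assume "j' \<in> {1..n} - {j}"
    then show "f (Src j') = exp (- (lam / real n) * (2 * \<delta>))"
      using measure_exp_gt[OF rate_pos[of "Src j'"], of "2 * \<delta>"] \<delta>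
      by (simp add: f_def first_contact_def rate_simps)
  qed
  also have "\<dots> = exp (- (2 * y / real n)) ^ (n - 1)"
    using j by (simp add: card_Diff_singleton y_def mult_ac)
  also have "\<dots> = exp (- (2 * y / real n) * real (n - 1))"
    by (subst exp_of_nat_mult[symmetric]) (simp add: mult.commute)
  finally have prod_eq: "(\<Prod>k\<in>procs n. f k) =
      f (Gsp j i) * (f (Src j) * exp (- (2 * y / real n) * real (n - 1)))" .
  have src: "y / (2 * real n) * exp (- (2 * y / real n)) \<le> f (Src j)"
  proof -
    \<comment> \<open>The exponent 3/2 is relaxed to 2, so that this factor completes the other n -
      1 to \<open>exp (- (2 * y))\<close>.\<close>
    have "y / (2 * real n) * exp (- (2 * y / real n)) \<le> y / (2 * real n) * exp (- (3 / 2 * (y / real n)))"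
      using y n_pos by (intro mult_left_mono) (auto simp: field_simps)
    also have "\<dots> = lam / real n * (3 / 2 * \<delta> - \<delta>) * exp (- (lam / real n) * (3 / 2 * \<delta>))"
    proof -
      have "- (3 / 2 * (y / real n)) = - (lam / real n) * (3 / 2 * \<delta>)" by (simp add: y_def)
      then show ?thesis by (simp only:) (simp add: y_def field_simps)
    qed
    also have "\<dots> \<le> measure (exp_measure (lam / real n)) {\<delta><..3 / 2 * \<delta>}"
      using lam n_pos \<delta> by (intro measure_exp_interval_ge) auto
    also have "\<dots> = f (Src j)" by (simp add: f_def first_contact_def rate_simps)
    finally show ?thesis .
  qed
  have gsp: "y / 4 * exp (- (7 / 2 * y)) \<le> f (Gsp j i)"
  proof -
    define r where "r = \<rho> (Gsp j i)"
    have r_eq: "r = real n * lam / (real n - 1)" by (simp add: r_def rate_simps)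
    \<comment> \<open>For n \<ge> 2 the rate r lies between lam and 2 lam: the lower bound serves
      the linear factor, the upper one the exponent 7/4, which becomes 7/2.\<close>
    have "2 * lam \<le> real n * lam" using n lam by (intro mult_right_mono) auto
    then have r: "lam \<le> r" "r \<le> 2 * lam"
      unfolding r_eq using n1 lam by (auto simp: field_simps)
    have "y / 4 * exp (- (7 / 2 * y)) \<le> r * \<delta> / 4 * exp (- (7 / 4 * (r * \<delta>)))"
      using r \<delta> lam by (intro mult_mono) (auto simp: y_def intro!: mult_right_mono)
    also have "\<dots> = r * (7 / 4 * \<delta> - 3 / 2 * \<delta>) * exp (- r * (7 / 4 * \<delta>))"
    proof -
      have "- (7 / 4 * (r * \<delta>)) = - r * (7 / 4 * \<delta>)" by simp
      then show ?thesis by (simp only:) (simp add: field_simps)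
    qed
    also have "\<dots> \<le> measure (exp_measure r) {3 / 2 * \<delta><..7 / 4 * \<delta>}"
      using lam r \<delta> by (intro measure_exp_interval_ge) auto
    also have "\<dots> = f (Gsp j i)" by (simp add: f_def first_contact_def r_def)
    finally show ?thesis .
  qed
  have e: "exp (- (2 * y / real n)) * exp (- (2 * y / real n) * real (n - 1)) = exp (- (2 * y))"
  proof -
    have "- (2 * y / real n) + - (2 * y / real n) * real (n - 1) = - (2 * y)"
      using n by (simp add: of_nat_diff field_simps)
    then show ?thesis by (simp only: exp_add[symmetric])
  qed
  have "2 * p0 / real n = y / 4 * exp (- (7 / 2 * y)) * (y / (2 * real n) * exp (- (2 * y)))"
  proof -
    have "exp (- (11 / 2) * y) = exp (- (7 / 2 * y)) * exp (- (2 * y))"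
      by (simp flip: exp_add)
    then show ?thesis
      unfolding p0_def y_def[symmetric] by (simp add: power2_eq_square)
  qed
  also have "\<dots> = y / 4 * exp (- (7 / 2 * y)) *
      ((y / (2 * real n) * exp (- (2 * y / real n))) * exp (- (2 * y / real n) * real (n - 1)))"
    unfolding e[symmetric] by (simp only: mult.assoc)
  also have "\<dots> \<le> f (Gsp j i) * (f (Src j) * exp (- (2 * y / real n) * real (n - 1)))"
    using y n_pos src by (intro mult_mono gsp src) (auto simp: f_def)
  also have "\<dots> = (\<Prod>k\<in>procs n. f k)" by (rule prod_eq[symmetric])
  finally show ?thesis unfolding f_def .
qed

text \<open>A run of \<open>l + 1\<close> failures is a run of \<open>l\<close> after the first
  window, minus the disjoint events that in addition the first window succeeds through some j. By
  the product formula each of these has probability \<open>p j\<close> times that of the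
  run.\<close>

lemma prob_fail_le:
  assumes i: "i \<in> {1..n}"
  shows "measure P {x \<in> space P. fail n \<delta> i l x} \<le> (1 - p0) ^ l"
proof (induction l)
  case 0
  show ?case by simp
next
  case (Suc l)
  let ?J = "{1..n} - {i}"
  define F where "F = {x \<in> space P. fail n \<delta> i l x}"
  define G where "G = {x \<in> space P. residual_config n (2 * \<delta>) x \<in> F}"
  define S where "S j = {x \<in> space P. (\<forall>k\<in>procs n. x k 0 \<in> first_contact n \<delta> i j k) \<and>
      residual_config n (2 * \<delta>) x \<in> F}" for j
  define p where "p j = (\<Prod>k\<in>procs n. measure (exp_measure (\<rho> k)) (first_contact n \<delta> i j k))" for j
  have F [measurable]: "F \<in> sets (config_borel n)"
    unfolding F_def sets_P[symmetric] by measurable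
  have G_sets: "G \<in> P.events" unfolding G_def by measurable
  have S_sets: "S j \<in> P.events" for j
  proof -
    have "Measurable.pred P (\<lambda>x. \<forall>k\<in>procs n. x k 0 \<in> first_contact n \<delta> i j k)"
      using measurable_config_nth
      by (intro pred_intros_finite pred_sets2[OF first_contact_borel]) (auto simp: measurable_cong_sets[OF sets_P refl])
    moreover have "Measurable.pred P (\<lambda>x. residual_config n (2 * \<delta>) x \<in> F)" by measurable
    ultimately show ?thesis unfolding S_def by (intro predE pred_intros_logic)
  qed
  have G: "P.prob G = P.prob F"
    using emeasure_residual_config[OF _ F, of "2 * \<delta>"] \<delta>
    unfolding G_def[symmetric] by (simp add: measure_def)
  have S: "P.prob (S j) = p j * P.prob F" if "j \<in> ?J" for j
  proof -
    have "emeasure P (S j) = (\<Prod>k\<in>procs n. emeasure (exp_measure (\<rho> k)) (first_contact n \<delta> i j k)) * emeasure P F"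
      unfolding S_def P_def
    proof (rule emeasure_PiM_first_residual)
      show "first_contact n \<delta> i j k \<subseteq> {..2 * \<delta>} \<or> first_contact n \<delta> i j k = {2 * \<delta><..} \<or>
          first_contact n \<delta> i j k = UNIV" for k
        using \<delta> by (cases k) (auto simp: first_contact_def)
    qed (use \<delta> rate_pos in auto)
    also have "(\<Prod>k\<in>procs n. emeasure (exp_measure (\<rho> k)) (first_contact n \<delta> i j k)) = ennreal (p j)"
      unfolding p_def prod_ennreal[OF measure_nonneg, symmetric]
      by (intro prod.cong refl finite_measure.emeasure_eq_measure prob_space.finite_measure
          prob_space_exp_measure rate_pos)
    finally have "ennreal (P.prob (S j)) = ennreal (p j) * ennreal (P.prob F)"
      by (simp add: P.emeasure_eq_measure)
    moreover have "0 \<le> p j" unfolding p_def by (intro prod_nonneg) auto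
    ultimately show ?thesis by (simp flip: ennreal_mult)
  qed
  have "{x \<in> space P. fail n \<delta> i (Suc l) x} = G - (\<Union>j\<in>?J. S j)"
    unfolding G_def S_def F_def success_def fail.simps
    by (auto simp: space_P residual_config_def)
  then have "P.prob {x \<in> space P. fail n \<delta> i (Suc l) x} = P.prob G - P.prob (\<Union>j\<in>?J. S j)"
    using G_sets S_sets by (simp add: P.finite_measure_Diff sets.finite_UN) (subst P.finite_measure_Diff, auto simp: G_def S_def)
  also have "P.prob (\<Union>j\<in>?J. S j) = (\<Sum>j\<in>?J. P.prob (S j))"
  proof (rule P.finite_measure_finite_Union)
    \<comment> \<open>The first contact of j comes by \<open>3/2 * \<delta>\<close> for success
      through j, but after \<open>2 * \<delta>\<close> for success through another node.\<close>
    show "disjoint_family_on S ?J"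
      unfolding disjoint_family_on_def
    proof safe
      fix j j' x assume j: "j \<in> {1..n}" "j' \<in> {1..n}" "j \<noteq> j'" and x: "x \<in> S j" "x \<in> S j'"
      have "x (Src j) 0 \<in> first_contact n \<delta> i j (Src j)" "x (Src j) 0 \<in> first_contact n \<delta> i j' (Src j)"
        using x j(1) by (auto simp: S_def)
      then show "x \<in> {}" using j \<delta> by (auto simp: first_contact_def)
    qed
  qed (use S_sets in auto)
  also have "\<dots> = (\<Sum>j\<in>?J. p j) * P.prob F"
    by (simp add: S sum_distrib_right)
  finally have eq: "P.prob {x \<in> space P. fail n \<delta> i (Suc l) x} = (1 - (\<Sum>j\<in>?J. p j)) * P.prob F"
    by (simp add: G algebra_simps)
  \<comment> \<open>The n - 1 choices of j each contribute at least 2 p0 / n, and n - 1 \<ge> n /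
    2.\<close>
  have "p0 \<le> real (n - 1) * (2 * p0 / real n)"
    using n p0_pos by (simp add: of_nat_diff field_simps)
  also have "\<dots> = (\<Sum>j\<in>?J. 2 * p0 / real n)"
    using i by (simp add: card_Diff_singleton)
  also have "\<dots> \<le> (\<Sum>j\<in>?J. p j)"
    unfolding p_def by (intro sum_mono prob_first_contact_ge i)
  finally have "P.prob {x \<in> space P. fail n \<delta> i (Suc l) x} \<le> (1 - p0) * P.prob F"
    unfolding eq by (intro mult_right_mono) auto
  also have "\<dots> \<le> (1 - p0) * (1 - p0) ^ l"
    using Suc p0_le_1 unfolding F_def by (intro mult_left_mono) auto
  finally show ?case by simp
qed

end

section \<open>The mean age\<close>

context gossip_net
begin

section \<open>Independence of version generation and failures\<close>

lemma measurable_P_Gen: "(\<lambda>x. x Gen) \<in> measurable P seq_borel"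
  unfolding measurable_cong_sets[OF sets_P refl] by (rule measurable_component_singleton) simp

text \<open>Failure does not see the \<open>Gen\<close> coordinate, so Fubini separates it from the
  increment; the restart law then removes the starting time b.\<close>

lemma nn_integral_gen_increment_fail:
  assumes ab: "0 \<le> a" "a \<le> b"
  shows "(\<integral>\<^sup>+x. ennreal (real (arrivals_upto (x Gen) b - arrivals_upto (x Gen) a)) *
        of_bool (fail n \<delta> i l (residual_config n b x)) \<partial>P) =
    (\<integral>\<^sup>+z. ennreal (real (arrivals_upto z (b - a))) \<partial>exp_seq lam_e) *
      emeasure P {x \<in> space P. fail n \<delta> i l x}"
proof -
  interpret product_sigma_finite "\<lambda>k. exp_seq (\<rho> k)"
    by (intro product_sigma_finite.intro prob_space_imp_sigma_finite prob_space_exp_seq rate_pos)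
  define J where "J = procs n - {Gen}"
  have J: "finite J" "Gen \<notin> J" "insert Gen J = procs n" by (auto simp: J_def)
  have P_eq: "P = PiM (insert Gen J) (\<lambda>k. exp_seq (\<rho> k))" by (simp add: P_def J)
  define PJ where "PJ = PiM J (\<lambda>k. exp_seq (\<rho> k))"
  have upd [measurable]: "(\<lambda>x. x(Gen := z)) \<in> measurable PJ P" for z
    unfolding PJ_def P_eq by (rule measurable_fun_upd[where J = J]) auto
  define N where "N z = ennreal (real (arrivals_upto z b - arrivals_upto z a))" for z
  define f where "f x = (of_bool (fail n \<delta> i l (residual_config n b x)) :: ennreal)" for x
  have [measurable]: "N \<in> borel_measurable seq_borel" unfolding N_def by measurable
  have [measurable]: "f \<in> borel_measurable P" unfolding f_def by measurable
  have [measurable]: "(\<lambda>x. N (x Gen)) \<in> borel_measurable P"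
    by (rule measurable_compose[OF measurable_P_Gen]) measurable
  \<comment> \<open>The integral is the same for every generation sequence; the zero sequence serves
    as reference value.\<close>
  define K where "K = (\<integral>\<^sup>+x. f (x(Gen := (\<lambda>_. 0))) \<partial>PJ)"
  have K: "(\<integral>\<^sup>+x. f (x(Gen := z)) \<partial>PJ) = K" for z
    unfolding K_def f_def
    by (intro nn_integral_cong arg_cong[where f = of_bool] fail_cong)
      (auto simp: residual_config_def restrict_def)
  have "(\<integral>\<^sup>+x. N (x Gen) * f x \<partial>P) = (\<integral>\<^sup>+z. \<integral>\<^sup>+x. N z * f (x(Gen := z)) \<partial>PJ \<partial>exp_seq (\<rho> Gen))"
    unfolding P_eq PJ_def using J by (subst product_nn_integral_insert_rev) (auto simp flip: P_eq)
  also have "\<dots> = (\<integral>\<^sup>+z. N z * K \<partial>exp_seq (\<rho> Gen))"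
    by (intro nn_integral_cong) (simp add: nn_integral_cmult K)
  also have "\<dots> = (\<integral>\<^sup>+z. N z \<partial>exp_seq lam_e) * K"
    by (subst nn_integral_multc) (auto simp: rate_simps)
  also have "(\<integral>\<^sup>+z. N z \<partial>exp_seq lam_e) = (\<integral>\<^sup>+z. ennreal (real (arrivals_upto z (b - a))) \<partial>exp_seq lam_e)"
    unfolding N_def using nn_integral_arrivals_increment[OF lam_e ab] .
  \<comment> \<open>Averaging the constant \<open>K\<close> over \<open>Gen\<close> restores the
    full product measure.\<close>
  also have "K = (\<integral>\<^sup>+z. \<integral>\<^sup>+x. f (x(Gen := z)) \<partial>PJ \<partial>exp_seq (\<rho> Gen))"
    using prob_space.emeasure_space_1[OF prob_space_exp_seq[OF rate_pos[of Gen]]] by (simp add: K)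
  also have "\<dots> = (\<integral>\<^sup>+x. f x \<partial>P)"
    unfolding P_eq PJ_def using J by (subst product_nn_integral_insert_rev) (auto simp flip: P_eq)
  also have "\<dots> = (\<integral>\<^sup>+x. of_bool (fail n \<delta> i l x) \<partial>P)"
    unfolding f_def using ab by (intro nn_integral_residual_config) auto
  also have "\<dots> = (\<integral>\<^sup>+x. indicator {x \<in> space P. fail n \<delta> i l x} x \<partial>P)"
    by (intro nn_integral_cong) (auto simp: indicator_def)
  also have "\<dots> = emeasure P {x \<in> space P. fail n \<delta> i l x}"
    by (rule nn_integral_indicator) measurable
  finally show ?thesis unfolding N_def f_def .
qed

section \<open>Means of truncated ages\<close>

definition window_mean :: ennreal where
  "window_mean = (\<integral>\<^sup>+z. ennreal (real (arrivals_upto z (2 * \<delta>))) \<partial>exp_seq lam_e)"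

definition mean_trunc :: "nat \<Rightarrow> real \<Rightarrow> real \<Rightarrow> ennreal" where
  "mean_trunc i a t = (\<integral>\<^sup>+x. ennreal (trunc_age n \<delta> i a t x) \<partial>P)"

lemma window_mean_finite: "window_mean < \<infinity>"
  unfolding window_mean_def by (rule nn_integral_arrivals_upto_finite[OF lam_e])

text \<open>Restarting preserves \<open>P\<close>, so the pathwise identity
  \<open>trunc_age_residual\<close> becomes invariance under time shifts.\<close>

lemma mean_trunc_shift:
  assumes "\<delta> \<le> a" "a \<le> t" "0 \<le> s"
  shows "mean_trunc i (a + s) (t + s) = mean_trunc i a t"
proof -
  have "mean_trunc i (a + s) (t + s) = (\<integral>\<^sup>+x. ennreal (trunc_age n \<delta> i a t (residual_config n s x)) \<partial>P)"
    unfolding mean_trunc_def using AE_regular_config assms \<delta>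
    by (intro nn_integral_cong_AE) (auto simp: trunc_age_residual elim!: eventually_mono)
  also have "\<dots> = mean_trunc i a t"
    unfolding mean_trunc_def using assms by (intro nn_integral_residual_config) auto
  finally show ?thesis .
qed

lemma mean_trunc_antimono: "a \<le> b \<Longrightarrow> mean_trunc i b t \<le> mean_trunc i a t"
  unfolding mean_trunc_def using AE_regular_config
  by (intro nn_integral_mono_AE) (auto intro!: ennreal_leI trunc_age_antimono elim!: eventually_mono)

text \<open>The mean of \<open>trunc_age_le\<close>; by independence the correction is an increment
  mean, at most that of a full window, times the probability of \<open>l\<close> failures.\<close>

lemma mean_trunc_le:
  assumes i: "i \<in> {1..n}" and ab: "0 \<le> a" "a \<le> b" "b - a \<le> 2 * \<delta>" and t: "b + real l * (2 * \<delta>) \<le> t"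
  shows "mean_trunc i a t \<le> mean_trunc i b t + window_mean * ennreal ((1 - p0) ^ l)"
proof -
  let ?N = "\<lambda>x. real (arrivals_upto (x Gen) b - arrivals_upto (x Gen) a)"
  let ?f = "\<lambda>x. fail n \<delta> i l (residual_config n b x)"
  have "(\<lambda>z. real (arrivals_upto z b - arrivals_upto z a)) \<in> borel_measurable seq_borel"
    by measurable
  from measurable_compose[OF measurable_P_Gen this]
  have [measurable]: "?N \<in> borel_measurable P" .
  have bt: "b \<le> t"
  proof -
    have "0 \<le> real l * (2 * \<delta>)" using \<delta> by simp
    with t show ?thesis by linarith
  qed
  have "mean_trunc i a t \<le>
      (\<integral>\<^sup>+x. ennreal (trunc_age n \<delta> i b t x) + ennreal (?N x) * of_bool (?f x) \<partial>P)"
    unfolding mean_trunc_def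
  proof (rule nn_integral_mono_AE)
    show "AE x in P. ennreal (trunc_age n \<delta> i a t x) \<le>
        ennreal (trunc_age n \<delta> i b t x) + ennreal (?N x) * of_bool (?f x)"
      using AE_regular_config
    proof eventually_elim
      case (elim x)
      have "ennreal (trunc_age n \<delta> i a t x) \<le> ennreal (trunc_age n \<delta> i b t x + ?N x * of_bool (?f x))"
        by (intro ennreal_leI trunc_age_le[OF elim \<delta> i ab(1,2) t])
      also have "\<dots> = ennreal (trunc_age n \<delta> i b t x) + ennreal (?N x) * of_bool (?f x)"
        using trunc_age_nonneg[OF elim bt] by (cases "?f x") (simp_all flip: ennreal_plus)
      finally show ?case .
    qed
  qed
  also have "\<dots> = mean_trunc i b t + (\<integral>\<^sup>+x. ennreal (?N x) * of_bool (?f x) \<partial>P)"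
    unfolding mean_trunc_def by (rule nn_integral_add) measurable
  also have "(\<integral>\<^sup>+x. ennreal (?N x) * of_bool (?f x) \<partial>P) =
      (\<integral>\<^sup>+z. ennreal (real (arrivals_upto z (b - a))) \<partial>exp_seq lam_e) *
        emeasure P {x \<in> space P. fail n \<delta> i l x}"
    by (rule nn_integral_gen_increment_fail[OF ab(1,2)])
  also have "\<dots> \<le> window_mean * ennreal ((1 - p0) ^ l)"
  proof (rule mult_mono)
    show "(\<integral>\<^sup>+z. ennreal (real (arrivals_upto z (b - a))) \<partial>exp_seq lam_e) \<le> window_mean"
      unfolding window_mean_def by (rule nn_integral_arrivals_upto_mono[OF lam_e ab(3)])
    show "emeasure P {x \<in> space P. fail n \<delta> i l x} \<le> ennreal ((1 - p0) ^ l)"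
      unfolding P.emeasure_eq_measure by (intro ennreal_leI prob_fail_le i)
  qed auto
  finally show ?thesis by (simp add: add_left_mono)
qed

text \<open>Advancing the truncation by one window costs the term for the \<open>l\<close> windows
  that remain, and a shift by 2 \<delta> returns it to \<delta> with one window fewer.\<close>

lemma mean_trunc_windows_le:
  assumes i: "i \<in> {1..n}"
  shows "mean_trunc i \<delta> (\<delta> + real l * (2 * \<delta>)) \<le> window_mean * ennreal (\<Sum>m<l. (1 - p0) ^ m)"
proof (induction l)
  case 0
  \<comment> \<open>Observation and truncation times coincide, so the minimum is at most zero, and
    \<open>ennreal\<close> sends it to zero.\<close>
  have "mean_trunc i \<delta> \<delta> = (\<integral>\<^sup>+x. 0 \<partial>P)"
    unfolding mean_trunc_def
    by (intro nn_integral_cong) (simp add: trunc_age_def ennreal_eq_0_iff)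
  then show ?case by simp
next
  case (Suc l)
  have Suc_l: "\<delta> + real (Suc l) * (2 * \<delta>) = (\<delta> + real l * (2 * \<delta>)) + 2 * \<delta>"
    by (simp add: algebra_simps)
  have "mean_trunc i \<delta> (\<delta> + real (Suc l) * (2 * \<delta>)) \<le>
      mean_trunc i (\<delta> + 2 * \<delta>) ((\<delta> + real l * (2 * \<delta>)) + 2 * \<delta>) + window_mean * ennreal ((1 - p0) ^ l)"
    unfolding Suc_l using \<delta> by (intro mean_trunc_le i) auto
  also have "mean_trunc i (\<delta> + 2 * \<delta>) ((\<delta> + real l * (2 * \<delta>)) + 2 * \<delta>) =
      mean_trunc i \<delta> (\<delta> + real l * (2 * \<delta>))"
    using \<delta> by (intro mean_trunc_shift) auto
  also have "mean_trunc i \<delta> (\<delta> + real l * (2 * \<delta>)) + window_mean * ennreal ((1 - p0) ^ l) \<le>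
      window_mean * ennreal (\<Sum>m<l. (1 - p0) ^ m) + window_mean * ennreal ((1 - p0) ^ l)"
    by (intro add_right_mono Suc)
  also have "\<dots> = window_mean * ennreal (\<Sum>m<Suc l. (1 - p0) ^ m)"
    using p0_le_1 by (simp add: sum_nonneg flip: distrib_left)
  finally show ?case .
qed

text \<open>A later observation time is, after a shift, an earlier truncation point.\<close>

lemma mean_trunc_mono:
  assumes "0 \<le> y" "y \<le> y'"
  shows "mean_trunc i \<delta> (\<delta> + y) \<le> mean_trunc i \<delta> (\<delta> + y')"
proof -
  have "mean_trunc i \<delta> (\<delta> + y) = mean_trunc i (\<delta> + (y' - y)) (\<delta> + y + (y' - y))"
    using assms \<delta> by (intro mean_trunc_shift[symmetric]) auto
  also have "\<dots> \<le> mean_trunc i \<delta> (\<delta> + y')"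
    using assms by (simp add: mean_trunc_antimono)
  finally show ?thesis .
qed

lemma mean_trunc_bounded:
  assumes i: "i \<in> {1..n}" and y: "0 \<le> y"
  shows "mean_trunc i \<delta> (\<delta> + y) \<le> window_mean * ennreal (1 / p0)"
proof -
  \<comment> \<open>Round up to whole windows by monotonicity; the geometric sum is at most 1 / p0
    for any number of them.\<close>
  obtain l :: nat where "y / (2 * \<delta>) \<le> real l" using real_arch_simple by blast
  then have "y \<le> real l * (2 * \<delta>)" using \<delta> by (simp add: field_simps)
  then have "mean_trunc i \<delta> (\<delta> + y) \<le> mean_trunc i \<delta> (\<delta> + real l * (2 * \<delta>))"
    by (rule mean_trunc_mono[OF y])
  also have "\<dots> \<le> window_mean * ennreal (\<Sum>m<l. (1 - p0) ^ m)"
    by (rule mean_trunc_windows_le[OF i])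
  also have "\<dots> \<le> window_mean * ennreal (1 / p0)"
  proof (intro mult_left_mono ennreal_leI)
    have "(\<Sum>m<l. (1 - p0) ^ m) = (1 - (1 - p0) ^ l) / p0"
      using p0_pos by (simp add: sum_gp_strict)
    also have "\<dots> \<le> 1 / p0"
      using p0_pos p0_le_1 by (intro divide_right_mono) auto
    finally show "(\<Sum>m<l. (1 - p0) ^ m) \<le> 1 / p0" .
  qed simp
  finally show ?thesis .
qed

section \<open>Convergence of the mean age\<close>

text \<open>The mean truncated at \<delta> increases to its supremum. The true mean, truncated at 0,
  exceeds it by at most a term decaying with the number of windows in [\<delta>, t], so it has the
  same limit.\<close>

lemma mean_age_converges:
  assumes i: "i \<in> {1..n}"
  shows "\<exists>a. a \<le> enn2real (window_mean * ennreal (1 / p0)) \<and>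
    ((\<lambda>t. \<integral>\<^sup>+x. ennreal (age n x \<delta> i t) \<partial>P) \<longlongrightarrow> ennreal a) at_top"
proof -
  define C where "C = window_mean * ennreal (1 / p0)"
  have C: "C < \<infinity>"
    using window_mean_finite unfolding C_def by (simp add: ennreal_mult_less_top)
  define G where "G y = mean_trunc i \<delta> (\<delta> + y)" for y
  define L where "L = (SUP y\<in>{0..}. G y)"
  have L: "L \<le> C"
    unfolding L_def G_def C_def by (intro SUP_least mean_trunc_bounded i) auto
  have "(G \<longlongrightarrow> L) at_top"
  proof (rule order_tendstoI)
    fix u assume "u < L"
    then obtain y where y: "0 \<le> y" "u < G y"
      unfolding L_def less_SUP_iff by auto
    show "\<forall>\<^sub>F z in at_top. u < G z"
      using eventually_ge_at_top[of y]
    proof eventually_elim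
      case (elim z)
      then show ?case using y mean_trunc_mono[OF y(1) elim, of i] by (auto simp: G_def)
    qed
  next
    fix u assume u: "L < u"
    show "\<forall>\<^sub>F z in at_top. G z < u"
      using eventually_ge_at_top[of 0]
    proof eventually_elim
      case (elim z)
      then have "G z \<le> L" unfolding L_def by (intro SUP_upper) auto
      with u show ?case by simp
    qed
  qed
  moreover have top: "filterlim (\<lambda>t. t - \<delta>) at_top at_top"
    using filterlim_tendsto_add_at_top[OF tendsto_const[of "- \<delta>"] filterlim_ident] by simp
  ultimately have lim1: "((\<lambda>t. G (t - \<delta>)) \<longlongrightarrow> L) at_top"
    by (rule filterlim_compose)
  \<comment> \<open>The number of complete windows between \<delta> and t; it tends to infinity, so
    the correction vanishes because p0 > 0.\<close>
  define l where "l t = nat \<lfloor>(t - \<delta>) / (2 * \<delta>)\<rfloor>" for t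
  define k where "k = enn2real window_mean"
  have k: "window_mean = ennreal k" using window_mean_finite by (simp add: k_def)
  have "filterlim (\<lambda>t. (t - \<delta>) / (2 * \<delta>)) at_top at_top"
    using filterlim_tendsto_pos_mult_at_top[OF tendsto_const[of "1 / (2 * \<delta>)"] _ top] \<delta> by simp
  then have "filterlim (\<lambda>t. \<lfloor>(t - \<delta>) / (2 * \<delta>)\<rfloor>) at_top at_top"
    by (rule filterlim_compose[OF filterlim_floor_sequentially])
  then have "filterlim l sequentially at_top"
    unfolding l_def by (rule filterlim_compose[OF filterlim_nat_sequentially])
  moreover have "(\<lambda>m. (1 - p0) ^ m) \<longlonglongrightarrow> 0"
    using p0_pos p0_le_1 by (intro LIMSEQ_realpow_zero) auto
  ultimately have "((\<lambda>t. (1 - p0) ^ l t) \<longlongrightarrow> 0) at_top"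
    by (rule filterlim_compose[rotated])
  then have "((\<lambda>t. ennreal (k * (1 - p0) ^ l t)) \<longlongrightarrow> ennreal (k * 0)) at_top"
    by (intro tendsto_ennrealI tendsto_mult_left)
  moreover have "ennreal (k * (1 - p0) ^ l t) = window_mean * ennreal ((1 - p0) ^ l t)" for t
    unfolding k by (simp add: ennreal_mult' k_def)
  ultimately have "((\<lambda>t. window_mean * ennreal ((1 - p0) ^ l t)) \<longlongrightarrow> 0) at_top" by simp
  with lim1 have lim2: "((\<lambda>t. G (t - \<delta>) + window_mean * ennreal ((1 - p0) ^ l t)) \<longlongrightarrow> L + 0) at_top"
    by (intro tendsto_add)
  have age: "(\<integral>\<^sup>+x. ennreal (age n x \<delta> i t) \<partial>P) = mean_trunc i 0 t" for t
    unfolding mean_trunc_def using AE_regular_config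
    by (intro nn_integral_cong_AE) (auto simp: trunc_age_0 elim!: eventually_mono)
  have "((\<lambda>t. mean_trunc i 0 t) \<longlongrightarrow> L) at_top"
  proof (rule tendsto_sandwich[OF _ _ lim1 lim2[unfolded add_0_right]])
    show "\<forall>\<^sub>F t in at_top. G (t - \<delta>) \<le> mean_trunc i 0 t"
      using \<delta> by (intro always_eventually allI) (simp add: G_def mean_trunc_antimono)
    show "\<forall>\<^sub>F t in at_top. mean_trunc i 0 t \<le> G (t - \<delta>) + window_mean * ennreal ((1 - p0) ^ l t)"
      using eventually_ge_at_top[of \<delta>]
    proof eventually_elim
      case (elim t)
      have "real (l t) \<le> (t - \<delta>) / (2 * \<delta>)"
        unfolding l_def using elim \<delta> by (simp add: of_nat_nat)
      then have "\<delta> + real (l t) * (2 * \<delta>) \<le> t" using \<delta> by (simp add: field_simps)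
      \<comment> \<open>Moving the truncation from 0 to \<delta> stays within the admissible
        distance 2 \<delta>.\<close>
      then show ?case using mean_trunc_le[OF i, of 0 \<delta> "l t" t] \<delta> by (simp add: G_def)
    qed
  qed
  \<comment> \<open>The limit is finite by the uniform bound, hence given by a real number.\<close>
  moreover have "L = ennreal (enn2real L)" using L C by (simp add: le_less_trans)
  moreover have "enn2real L \<le> enn2real C" using L C by (intro enn2real_mono) auto
  ultimately show ?thesis unfolding age C_def by auto
qed

end

section \<open>Transfer to an arbitrary probability space\<close>

theorem theorem3:
  fixes M :: "'a measure"
    and X :: "nat \<Rightarrow> proc \<Rightarrow> nat \<Rightarrow> 'a \<Rightarrow> real"
    and lam_e lam delta :: real
  assumes "prob_space M"
    and "lam_e > 0" and "lam > 0" and "delta > 0"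
    and model: "\<And>n. n \<ge> 2 \<Longrightarrow> gossip_model M n lam_e lam (real n * lam) (X n)"
  shows "\<exists>C::real. \<forall>\<^sub>F n in sequentially. \<forall>i\<in>{1..n}. \<exists>a::real. a \<le> C \<and>
           ((\<lambda>t. \<integral>\<^sup>+ \<omega>. ennreal (age n (\<lambda>k m. X n k m \<omega>) delta i t) \<partial>M)
              \<longlongrightarrow> ennreal a) at_top"
proof -
  interpret M: prob_space M by fact
  \<comment> \<open>Neither \<open>window_mean\<close> nor \<open>p0\<close> depends on n, which
    makes the bound uniform.\<close>
  define C where "C = enn2real (gossip_net.window_mean lam_e delta * ennreal (1 / gossip_net.p0 lam delta))"
  have "\<exists>a::real. a \<le> C \<and> ((\<lambda>t. \<integral>\<^sup>+ \<omega>. ennreal (age n (\<lambda>k m. X n k m \<omega>) delta i t) \<partial>M)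
              \<longlongrightarrow> ennreal a) at_top" if n: "2 \<le> n" and i: "i \<in> {1..n}" for n i
  proof -
    interpret gossip_net n lam_e lam delta
      using assms n by unfold_locales auto
    \<comment> \<open>By \<open>age_cong\<close> restricting to \<open>procs n\<close> leaves the
      age unchanged, and it gives points of the product space with law \<open>P\<close>.\<close>
    let ?Y = "\<lambda>\<omega>. \<lambda>k\<in>procs n. \<lambda>m. X n k m \<omega>"
    have P: "distr M (config_borel n) ?Y = P"
      unfolding P_def by (rule M.distr_gossip_model[OF model[OF n]])
    have Y: "?Y \<in> measurable M (config_borel n)"
    proof (rule measurable_restrict)
      fix k assume k: "k \<in> procs n"
      show "(\<lambda>\<omega> m. X n k m \<omega>) \<in> measurable M seq_borel"
      proof (rule measurable_PiM_single')
        show "(\<lambda>\<omega>. X n k m \<omega>) \<in> borel_measurable M" for m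
          using model[OF n] k distributed_measurable[of M lborel "X n k m"]
          by (auto simp: gossip_model_def)
      qed (auto simp: space_PiM)
    qed
    have "(\<integral>\<^sup>+ \<omega>. ennreal (age n (\<lambda>k m. X n k m \<omega>) delta i t) \<partial>M) = (\<integral>\<^sup>+x. ennreal (age n x delta i t) \<partial>P)" for t
    proof -
      have "(\<integral>\<^sup>+ \<omega>. ennreal (age n (\<lambda>k m. X n k m \<omega>) delta i t) \<partial>M) =
          (\<integral>\<^sup>+ \<omega>. ennreal (age n (?Y \<omega>) delta i t) \<partial>M)"
        by (intro nn_integral_cong arg_cong[where f = ennreal] age_cong) simp
      also have "\<dots> = (\<integral>\<^sup>+x. ennreal (age n x delta i t) \<partial>distr M (config_borel n) ?Y)"
        by (rule nn_integral_distr[symmetric, OF Y]) measurable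
      finally show ?thesis unfolding P .
    qed
    then show ?thesis using mean_age_converges[OF i] by (simp add: C_def)
  qed
  then show ?thesis
    by (intro exI[of _ C] eventually_sequentiallyI[of 2]) auto
qed

end
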